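(* Let $X_{gr}$ be the Polish space of graphs on $\omega$. Let $\preceq_{epi}$ be the quasi-order on $X_{gr}$ given by $H\preceq_{epi}H'$ iff there is a surjection $\gamma\colon\omega\to\omega$ such that whenever $n,m$ are adjacent in $H'$, $\gamma(n),\gamma(m)$ are adjacent in $H$. Then the pair $(\preceq_{epi},\cong)$, where $\cong$ is isomorphism of graphs, is invariantly universal. Equivalently, for every analytic quasi-order $R$ on a standard Borel space there is an $\mathcal{L}_{\omega_1\omega}$-sentence $\varphi$ (in the language of one binary relation), all of whose countable models on $\omega$ are graphs, such that $R$ is Borel bireducible with the restriction of $\preceq_{epi}$ to $\mathrm{Mod}_\varphi$.
   Context: Borel reducibility: for binary relations $R,R'$ on standard Borel spaces $X,X'$, a Borel $h\colon X\to X'$ with $x\,R\,y \iff h(x)\,R'\,h(y)$ is a Borel reduction, written $R\le_B R'$; $R\sim_B R'$ means $R\le_B R'\le_B R$. For an analytic quasi-order $S$ on a standard Borel space $X$ and an analytic equivalence relation $E\subseteq S\cap S^{-1}$ on $X$, the pair $(S,E)$ is invariantly universal if for every analytic quasi-order $R$ on a standard Borel space there is a Borel $E$-invariant $B\subseteq X$ with $R\sim_B S\restriction B$. $\mathrm{Mod}_\varphi$ denotes the set of structures with universe $\omega$ satisfying $\varphi$. *)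

theory Defs
  imports "HOL-Analysis.Analysis"
begin

section \<open>Standard Borel spaces and analytic sets\<close>

definition polish_space :: "'a topology \<Rightarrow> bool" where
  "polish_space T \<longleftrightarrow> completely_metrizable_space T \<and> separable_space T"

definition borel_of :: "'a topology \<Rightarrow> 'a measure" where
  "borel_of T = sigma (topspace T) {U. openin T U}"

(* Only the space and the sigma-algebra of a "measure" matter in this theory. *)
definition standard_borel :: "'a measure \<Rightarrow> bool" where
  "standard_borel M \<longleftrightarrow>
     (\<exists>T. polish_space T \<and> space M = topspace T \<and> sets M = sets (borel_of T))"

(* Projections of Borel subsets of M \<times> \<omega>\<^sup>\<omega>; the Borel structure on nat \<Rightarrow> nat is that of
   the product topology with discrete factors, i.e. of the Baire space. *)
definition analytic_in :: "'a measure \<Rightarrow> 'a set \<Rightarrow> bool" where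
  "analytic_in M A \<longleftrightarrow>
     (\<exists>C \<in> sets (M \<Otimes>\<^sub>M (borel :: (nat \<Rightarrow> nat) measure)). A = fst ` C)"

definition analytic_quasi_order :: "'a measure \<Rightarrow> 'a rel \<Rightarrow> bool" where
  "analytic_quasi_order M R \<longleftrightarrow> preorder_on (space M) R \<and> analytic_in (M \<Otimes>\<^sub>M M) R"

definition analytic_equivalence :: "'a measure \<Rightarrow> 'a rel \<Rightarrow> bool" where
  "analytic_equivalence M E \<longleftrightarrow> equiv (space M) E \<and> analytic_in (M \<Otimes>\<^sub>M M) E"


section \<open>Borel reducibility and invariant universality\<close>

definition borel_reducible :: "'a measure \<Rightarrow> 'a rel \<Rightarrow> 'b measure \<Rightarrow> 'b rel \<Rightarrow> bool" where
  "borel_reducible M R N S \<longleftrightarrow>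
     (\<exists>h \<in> measurable M N. \<forall>x \<in> space M. \<forall>y \<in> space M. (x, y) \<in> R \<longleftrightarrow> (h x, h y) \<in> S)"

definition borel_bireducible :: "'a measure \<Rightarrow> 'a rel \<Rightarrow> 'b measure \<Rightarrow> 'b rel \<Rightarrow> bool" where
  "borel_bireducible M R N S \<longleftrightarrow> borel_reducible M R N S \<and> borel_reducible N S M R"

(* The type argument is the type carrying the standard Borel spaces over which the universal
   quantifier ranges: HOL cannot quantify over types inside a definition. Leaving 'b free in a
   theorem gives the assertion for all standard Borel spaces. *)
definition invariantly_universal :: "'b itself \<Rightarrow> 'a measure \<Rightarrow> 'a rel \<Rightarrow> 'a rel \<Rightarrow> bool" where
  "invariantly_universal (ty :: 'b itself) X S E \<longleftrightarrow>
     standard_borel X \<and> analytic_quasi_order X S \<and> analytic_equivalence X E \<and> E \<subseteq> S \<inter> S\<inverse> \<and>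
     (\<forall>(Y :: 'b measure) R. standard_borel Y \<and> analytic_quasi_order Y R \<longrightarrow>
        (\<exists>B \<in> sets X. E `` B \<subseteq> B \<and>
           borel_bireducible Y R (restrict_space X B) (S \<inter> B \<times> B)))"


section \<open>The space of graphs on the natural numbers\<close>

(* Undirected and loop-free; a binary relation on \<omega> is given by its characteristic function. *)
definition graphs :: "(nat \<times> nat \<Rightarrow> bool) set" where
  "graphs = {H. (\<forall>n. \<not> H (n, n)) \<and> (\<forall>n m. H (n, m) \<longrightarrow> H (m, n))}"

(* Subspace topology from 2^(\<omega> \<times> \<omega>), the product of discrete two-point spaces. *)
definition graph_topology :: "(nat \<times> nat \<Rightarrow> bool) topology" where
  "graph_topology = subtopology euclidean graphs"

definition graph_space :: "(nat \<times> nat \<Rightarrow> bool) measure" where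
  "graph_space = borel_of graph_topology"

(* The epimorphism goes from the second graph onto the first. *)
definition epi_le :: "(nat \<times> nat \<Rightarrow> bool) rel" where
  "epi_le = {(H, H'). H \<in> graphs \<and> H' \<in> graphs \<and>
     (\<exists>\<gamma> :: nat \<Rightarrow> nat. surj \<gamma> \<and> (\<forall>n m. H' (n, m) \<longrightarrow> H (\<gamma> n, \<gamma> m)))}"

definition graph_iso :: "(nat \<times> nat \<Rightarrow> bool) rel" where
  "graph_iso = {(H, H'). H \<in> graphs \<and> H' \<in> graphs \<and>
     (\<exists>\<pi> :: nat \<Rightarrow> nat. bij \<pi> \<and> (\<forall>n m. H (n, m) \<longleftrightarrow> H' (\<pi> n, \<pi> m)))}"


section \<open>Infinitary logic with one binary relation symbol\<close>

(* Formulas of L_{\<omega>1\<omega>}, with variables indexed by nat. Finite conjunctions and disjunctions are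
   countable ones with repetitions. The usual requirement that every formula has only finitely
   many free variables is automatic for subformulas of sentences, since a subformula lies in the
   scope of only finitely many quantifiers. *)
datatype fm =
    Eq nat nat
  | Adj nat nat
  | Neg fm
  | Conj "nat \<Rightarrow> fm"
  | Disj "nat \<Rightarrow> fm"
  | All nat fm
  | Ex nat fm

primrec free_vars :: "fm \<Rightarrow> nat set" where
  "free_vars (Eq i j) = {i, j}"
| "free_vars (Adj i j) = {i, j}"
| "free_vars (Neg p) = free_vars p"
| "free_vars (Conj f) = (\<Union>k. free_vars (f k))"
| "free_vars (Disj f) = (\<Union>k. free_vars (f k))"
| "free_vars (All i p) = free_vars p - {i}"
| "free_vars (Ex i p) = free_vars p - {i}"

definition is_sentence :: "fm \<Rightarrow> bool" where
  "is_sentence p \<longleftrightarrow> free_vars p = {}"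

primrec sat :: "(nat \<times> nat \<Rightarrow> bool) \<Rightarrow> fm \<Rightarrow> (nat \<Rightarrow> nat) \<Rightarrow> bool" where
  "sat H (Eq i j) v \<longleftrightarrow> v i = v j"
| "sat H (Adj i j) v \<longleftrightarrow> H (v i, v j)"
| "sat H (Neg p) v \<longleftrightarrow> \<not> sat H p v"
| "sat H (Conj f) v \<longleftrightarrow> (\<forall>k. sat H (f k) v)"
| "sat H (Disj f) v \<longleftrightarrow> (\<exists>k. sat H (f k) v)"
| "sat H (All i p) v \<longleftrightarrow> (\<forall>x. sat H p (v(i := x)))"
| "sat H (Ex i p) v \<longleftrightarrow> (\<exists>x. sat H p (v(i := x)))"

(* For a sentence the assignment v is irrelevant. *)
definition Mod :: "fm \<Rightarrow> (nat \<times> nat \<Rightarrow> bool) set" where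
  "Mod p = {H. \<forall>v. sat H p v}"

end

theory Submission
  imports Defs
begin

text \<open>
  Let \<open>S\<close> be the converse of the given quasi-order, transported to a Borel set \<open>B\<close> of bit sequences,
  and write \<open>(x, y) \<in> S\<close> as \<open>\<exists>\<alpha>. \<forall>n. P ((x, y, \<alpha>)|n)\<close>. For \<open>x \<in> B\<close> consider the tree of finite
  approximations of chains \<open>z\<^sub>0, \<alpha>\<^sub>1, z\<^sub>1, \<dots>, \<alpha>\<^sub>k, z\<^sub>k = x\<close> of witnesses, labelled by the bits of
  \<open>z\<^sub>0\<close>. Appending a witness of \<open>(x, y) \<in> S\<close> maps the tree of \<open>x\<close> to that of \<open>y\<close>; conversely, a label
  preserving map carries the branch \<open>k = 0\<close>, which is labelled by \<open>x\<close>, to a chain from \<open>x\<close> to \<open>y\<close>.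
  Attaching the nodes to a finite rigid graph, every vertex of which lies in a triangle while no other
  triangles are created, turns levels (mod 3) and labels into adjacencies that every graph homomorphism
  respects.

  If the source graph has infinitely many isolated vertices, every homomorphism can be made surjective, so
  \<open>epi_le\<close> becomes the homomorphism order. To make the set of these graphs invariant and definable,
  vertex \<open>j\<close> is marked by \<open>j + 1\<close> leaves, which can be folded away; the marks are first-order definable, hence
  the isomorphism types of the marked versions of a Borel set of graphs are axiomatised by a single
  sentence, from whose models \<open>x\<close> can be read off in a Borel way.
\<close>

section \<open>Coding standard Borel spaces and analytic relations\<close>

text \<open>With second countable factors, a map into a countable power of \<open>bool\<close> is
  Borel as soon as its coordinates are.\<close>

instance bool :: second_countable_topology
proof
  have "open = generate_topology (UNIV :: bool set set)"
    by (simp add: fun_eq_iff) (metis UNIV_I generate_topology.Basis open_discrete)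
  then show "\<exists>B::bool set set. countable B \<and> open = generate_topology B"
    by (intro exI[of _ UNIV]) simp
qed

lemma sets_borel_discrete: "sets (borel :: 'a::discrete_topology measure) = UNIV"
  by (auto intro: borel_open open_discrete)

lemma measurable_borel_discrete:
  "measurable M (borel :: 'a::discrete_topology measure) = measurable M (count_space UNIV)"
  by (rule measurable_cong_sets) (auto simp: sets_borel_discrete)

lemma measurable_fun_discreteI:
  fixes f :: "'a \<Rightarrow> 'i::countable \<Rightarrow> 'b::{discrete_topology, second_countable_topology}"
  assumes "\<And>i. (\<lambda>x. f x i) \<in> measurable M (count_space UNIV)"
  shows "f \<in> borel_measurable M"
  by (rule measurable_coordinatewise_then_product) (use assms in \<open>simp add: measurable_borel_discrete\<close>)

lemma measurable_fun_discreteD: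
  "(\<lambda>x. x i) \<in> measurable (borel :: ('i::countable \<Rightarrow> 'b::{discrete_topology, second_countable_topology}) measure) (count_space UNIV)"
proof -
  have "(\<lambda>x. x i) \<in> borel_measurable (borel :: ('i \<Rightarrow> 'b) measure)"
    by (rule borel_measurable_continuous_onI) (rule continuous_on_product_coordinates)
  then show ?thesis by (simp add: measurable_borel_discrete)
qed

section \<open>Closed sets of sequences and the tree form of analytic relations\<close>

text \<open>Closedness in the countable power of the discrete space \<open>'e\<close>, phrased by
  initial segments so that letters of any type can be used.\<close>

definition seq_closed :: "((nat \<Rightarrow> 'e) \<Rightarrow> bool) \<Rightarrow> bool" where
  "seq_closed F \<longleftrightarrow> (\<forall>f. (\<forall>n. \<exists>g. F g \<and> (\<forall>i<n. g i = f i)) \<longrightarrow> F f)"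

lemma seq_closedD: "seq_closed F \<Longrightarrow> (\<And>n. \<exists>g. F g \<and> (\<forall>i<n. g i = f i)) \<Longrightarrow> F f"
  unfolding seq_closed_def by blast

text \<open>\<open>fin\<close> is uniform continuity of \<open>h\<close>: the bound \<open>N\<close>
  does not depend on the sequence.\<close>

lemma seq_closed_vimage:
  assumes "seq_closed F" and fin: "\<And>n. \<exists>N. \<forall>f g. (\<forall>i<N. f i = g i) \<longrightarrow> (\<forall>i<n. h f i = h g i)"
  shows "seq_closed (\<lambda>f. F (h f))"
  unfolding seq_closed_def
proof (intro allI impI)
  fix f assume *: "\<forall>n. \<exists>g. F (h g) \<and> (\<forall>i<n. g i = f i)"
  show "F (h f)"
  proof (rule seq_closedD[OF assms(1)])
    fix n
    obtain N where N: "\<And>f g. (\<forall>i<N. f i = g i) \<Longrightarrow> (\<forall>i<n. h f i = h g i)" using fin by meson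
    obtain g where "F (h g)" "\<forall>i<N. g i = f i" using * by blast
    then show "\<exists>g. F g \<and> (\<forall>i<n. g i = h f i)" using N by blast
  qed
qed

lemma seq_closed_all:
  assumes "\<And>m. seq_closed (F m)"
  shows "seq_closed (\<lambda>f. \<forall>m. F m f)"
  unfolding seq_closed_def
proof (intro allI impI)
  fix f m assume *: "\<forall>n. \<exists>g. (\<forall>m. F m g) \<and> (\<forall>i<n. g i = f i)"
  show "F m f"
  proof (rule seq_closedD[OF assms])
    show "\<exists>g. F m g \<and> (\<forall>i<n. g i = f i)" for n using *[rule_format, of n] by blast
  qed
qed

lemma seq_closed_iff:
  assumes "seq_closed F"
  shows "F f \<longleftrightarrow> (\<forall>n. \<exists>g. F g \<and> map f [0..<n] = map g [0..<n])"
proof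
  assume *: "\<forall>n. \<exists>g. F g \<and> map f [0..<n] = map g [0..<n]"
  show "F f"
    by (rule seq_closedD[OF assms]) (use * in force)
qed blast

text \<open>Projections of closed sets along Baire space, where a point \<open>w\<close> is seen
  only through the sequence \<open>c w\<close>.\<close>

definition suslin :: "('w \<Rightarrow> nat \<Rightarrow> 'c) \<Rightarrow> 'w set \<Rightarrow> bool" where
  "suslin c A \<longleftrightarrow> (\<exists>F. seq_closed F \<and> (\<forall>w. w \<in> A \<longleftrightarrow> (\<exists>\<alpha> :: nat \<Rightarrow> nat. F (\<lambda>i. (c w i, \<alpha> i)))))"

lemma suslin_cylinder: "suslin c {w. Q (c w i)}"
  unfolding suslin_def
proof (intro exI conjI)
  show "seq_closed (\<lambda>f :: nat \<Rightarrow> 'b \<times> nat. Q (fst (f i)))"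
    unfolding seq_closed_def by (metis lessI)
qed auto

text \<open>The first entry of the new witness names a member of the union; the remaining entries,
  shifted by one, are a witness for that member.\<close>

lemma suslin_UN:
  assumes "\<And>m :: nat. suslin c (A m)"
  shows "suslin c (\<Union>m. A m)"
proof -
  obtain F where F: "\<And>m. seq_closed (F m)" "\<And>m w. w \<in> A m \<longleftrightarrow> (\<exists>\<alpha> :: nat \<Rightarrow> nat. F m (\<lambda>i. (c w i, \<alpha> i)))"
    using assms unfolding suslin_def by metis
  define G where "G = (\<lambda>f. F (snd (f 0)) (\<lambda>i. (fst (f i), snd (f (Suc i)))))"
  have "seq_closed G"
    unfolding seq_closed_def
  proof (intro allI impI)
    fix f assume *: "\<forall>n. \<exists>g. G g \<and> (\<forall>i<n. g i = f i)"
    show "G f" unfolding G_def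
    proof (rule seq_closedD[OF F(1)])
      fix n
      obtain g where "G g" "\<forall>i<Suc n. g i = f i" using * by blast
      then show "\<exists>h. F (snd (f 0)) h \<and> (\<forall>i<n. h i = (fst (f i), snd (f (Suc i))))"
        unfolding G_def by (intro exI[of _ "\<lambda>i. (fst (g i), snd (g (Suc i)))"]) auto
    qed
  qed
  moreover have "w \<in> (\<Union>m. A m) \<longleftrightarrow> (\<exists>\<alpha> :: nat \<Rightarrow> nat. G (\<lambda>i. (c w i, \<alpha> i)))" for w
  proof
    assume "w \<in> (\<Union>m. A m)"
    then obtain m \<alpha> where "F m (\<lambda>i. (c w i, \<alpha> i))" using F(2) by blast
    then show "\<exists>\<alpha> :: nat \<Rightarrow> nat. G (\<lambda>i. (c w i, \<alpha> i))"
      unfolding G_def by (intro exI[of _ "case_nat m \<alpha>"]) simp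
  next
    assume "\<exists>\<alpha> :: nat \<Rightarrow> nat. G (\<lambda>i. (c w i, \<alpha> i))"
    then show "w \<in> (\<Union>m. A m)" unfolding G_def using F(2) by auto
  qed
  ultimately show ?thesis unfolding suslin_def by blast
qed

text \<open>Witnesses for all members are interleaved along \<open>prod_encode\<close>. The
  condition on each subsequence stays closed, since finitely many of its entries lie in an initial
  segment.\<close>

lemma suslin_INT:
  assumes "\<And>m :: nat. suslin c (A m)"
  shows "suslin c (\<Inter>m. A m)"
proof -
  obtain F where F: "\<And>m. seq_closed (F m)" "\<And>m w. w \<in> A m \<longleftrightarrow> (\<exists>\<alpha> :: nat \<Rightarrow> nat. F m (\<lambda>i. (c w i, \<alpha> i)))"
    using assms unfolding suslin_def by metis
  define G where "G = (\<lambda>f. \<forall>m. F m (\<lambda>i. (fst (f i), snd (f (prod_encode (m, i))))))"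
  have "seq_closed (\<lambda>f. F m (\<lambda>i. (fst (f i), snd (f (prod_encode (m, i))))))" for m
  proof (rule seq_closed_vimage[OF F(1)])
    fix n
    obtain N where N: "\<And>i. i < n \<Longrightarrow> prod_encode (m, i) < N"
    proof -
      have "finite ((\<lambda>i. prod_encode (m, i)) ` {..<n})" by simp
      then obtain N where "\<forall>k \<in> (\<lambda>i. prod_encode (m, i)) ` {..<n}. k < N"
        using finite_nat_set_iff_bounded by blast
      then show ?thesis by (intro that[of N]) simp
    qed
    show "\<exists>N. \<forall>f g. (\<forall>i<N. f i = g i) \<longrightarrow>
       (\<forall>i<n. (fst (f i), snd (f (prod_encode (m, i)))) = (fst (g i), snd (g (prod_encode (m, i)))))"
      by (intro exI[of _ "max n N"] allI impI) (simp add: N less_max_iff_disj)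
  qed
  then have "seq_closed G" unfolding G_def by (rule seq_closed_all)
  moreover have "w \<in> (\<Inter>m. A m) \<longleftrightarrow> (\<exists>\<alpha> :: nat \<Rightarrow> nat. G (\<lambda>i. (c w i, \<alpha> i)))" for w
  proof
    assume "w \<in> (\<Inter>m. A m)"
    then obtain \<alpha> where "\<And>m. F m (\<lambda>i. (c w i, \<alpha> m i))" using F(2) by (metis INT_iff UNIV_I)
    then show "\<exists>\<alpha> :: nat \<Rightarrow> nat. G (\<lambda>i. (c w i, \<alpha> i))"
      unfolding G_def by (intro exI[of _ "\<lambda>k. case_prod \<alpha> (prod_decode k)"]) simp
  next
    assume "\<exists>\<alpha> :: nat \<Rightarrow> nat. G (\<lambda>i. (c w i, \<alpha> i))"
    then obtain \<alpha> :: "nat \<Rightarrow> nat" where "\<And>m. F m (\<lambda>i. (c w i, \<alpha> (prod_encode (m, i))))"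
      unfolding G_def by auto
    then have "w \<in> A m" for m
      unfolding F(2) by (intro exI[of _ "\<lambda>i. \<alpha> (prod_encode (m, i))"])
    then show "w \<in> (\<Inter>m. A m)" by blast
  qed
  ultimately show ?thesis unfolding suslin_def by blast
qed

text \<open>The sets that are Suslin together with their complements form a sigma-algebra containing
  the cylinders.\<close>

lemma suslin_borel:
  fixes c :: "((nat \<Rightarrow> bool) \<times> (nat \<Rightarrow> bool)) \<times> (nat \<Rightarrow> nat) \<Rightarrow> nat \<Rightarrow> bool \<times> bool \<times> nat"
  assumes c: "\<And>x y b i. c ((x, y), b) i = (x i, y i, b i)"
    and C: "C \<in> sets ((borel \<Otimes>\<^sub>M borel) \<Otimes>\<^sub>M borel)"
  shows "suslin c C"
proof -
  define S where "S = {A. suslin c A \<and> suslin c (- A)}"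
  have cyl: "{w. Q (c w i)} \<in> S" for Q i
    unfolding S_def using suslin_cylinder[of c Q] suslin_cylinder[of c "\<lambda>v. \<not> Q v"]
    by (auto simp: Collect_neg_eq[symmetric])
  have "sigma_algebra UNIV S"
    unfolding sigma_algebra_iff2
  proof (intro conjI ballI allI impI)
    show "{} \<in> S" using cyl[of "\<lambda>_. False"] by simp
    show "UNIV - A \<in> S" if "A \<in> S" for A
      using that unfolding S_def by (simp add: Compl_eq_Diff_UNIV[symmetric])
    show "(\<Union>m. A m) \<in> S" if "range A \<subseteq> S" for A :: "nat \<Rightarrow> _"
      using that unfolding S_def by (auto simp: image_subset_iff intro!: suslin_UN suslin_INT)
  qed auto
  define M where "M = sigma UNIV S"
  have M: "sets M = S" "space M = UNIV"
    unfolding M_def using \<open>sigma_algebra UNIV S\<close>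
    by (auto simp: sigma_algebra.sigma_sets_eq)
  have meas: "(\<lambda>w. h (c w i)) \<in> measurable M (count_space UNIV)" for h :: "_ \<Rightarrow> 'z" and i
  proof (rule measurableI)
    fix X :: "'z set"
    show "(\<lambda>w. h (c w i)) -` X \<inter> space M \<in> sets M"
      using cyl[of "\<lambda>v. h v \<in> X" i] by (simp add: M vimage_def)
  qed simp
  have c': "c w i = (fst (fst w) i, snd (fst w) i, snd w i)" for w i
    using c by (cases w; cases "fst w") auto
  have 1: "(\<lambda>w. fst (fst w)) \<in> borel_measurable M"
    by (rule measurable_fun_discreteI) (use meas[of fst] in \<open>simp add: c'\<close>)
  have 2: "(\<lambda>w. snd (fst w)) \<in> borel_measurable M"
    by (rule measurable_fun_discreteI) (use meas[of "\<lambda>v. fst (snd v)"] in \<open>simp add: c'\<close>)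
  have 3: "(\<lambda>w. snd w) \<in> borel_measurable M"
    by (rule measurable_fun_discreteI) (use meas[of "\<lambda>v. snd (snd v)"] in \<open>simp add: c'\<close>)
  \<comment> \<open>This map is the identity, so its measurability puts every Borel set into
    \<open>S\<close>.\<close>
  have "(\<lambda>w. ((fst (fst w), snd (fst w)), snd w)) \<in> measurable M ((borel \<Otimes>\<^sub>M borel) \<Otimes>\<^sub>M borel)"
    by (intro measurable_Pair 1 2 3)
  from measurable_sets[OF this C] show ?thesis by (simp add: M S_def)
qed

text \<open>The point of Baire space projected away from \<open>C\<close> and the Suslin witness for
  \<open>C\<close> are merged by \<open>prod_encode\<close> into one
  \<open>\<alpha>\<close>.\<close>

lemma analytic_normal_form:
  fixes R :: "(nat \<Rightarrow> bool) rel"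
  assumes "analytic_in (borel \<Otimes>\<^sub>M borel) R"
  shows "\<exists>P :: (bool \<times> bool \<times> nat) list \<Rightarrow> bool.
    \<forall>x y. (x, y) \<in> R \<longleftrightarrow> (\<exists>\<alpha>. \<forall>n. P (map (\<lambda>i. (x i, y i, \<alpha> i)) [0..<n]))"
proof -
  define c where "c = ((\<lambda>((x, y), b) i. (x i, y i, b i))
    :: ((nat \<Rightarrow> bool) \<times> (nat \<Rightarrow> bool)) \<times> (nat \<Rightarrow> nat) \<Rightarrow> nat \<Rightarrow> bool \<times> bool \<times> nat)"
  obtain C where C: "C \<in> sets ((borel \<Otimes>\<^sub>M borel) \<Otimes>\<^sub>M (borel :: (nat \<Rightarrow> nat) measure))" "R = fst ` C"
    using assms unfolding analytic_in_def by blast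
  have "suslin c C" by (rule suslin_borel[OF _ C(1)]) (simp add: c_def)
  then obtain F where F: "seq_closed F" "\<And>w. w \<in> C \<longleftrightarrow> (\<exists>\<alpha> :: nat \<Rightarrow> nat. F (\<lambda>i. (c w i, \<alpha> i)))"
    unfolding suslin_def by blast
  define G where "G = (\<lambda>f. F (\<lambda>i. case f i of (a, b, k) \<Rightarrow> ((a, b, fst (prod_decode k)), snd (prod_decode k))))"
  have G: "seq_closed G"
    unfolding G_def
  proof (rule seq_closed_vimage[OF F(1)])
    show "\<exists>N. \<forall>f g. (\<forall>i<N. f i = g i) \<longrightarrow> (\<forall>i<n.
        (case f i of (a, b, k) \<Rightarrow> ((a, b, fst (prod_decode k)), snd (prod_decode k))) =
        (case g i of (a, b, k) \<Rightarrow> ((a, b, fst (prod_decode k)), snd (prod_decode k))))" for n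
      by (rule exI[of _ n]) simp
  qed
  have 1: "(x, y) \<in> R \<longleftrightarrow> (\<exists>\<alpha>. G (\<lambda>i. (x i, y i, \<alpha> i)))" for x y
  proof
    assume "(x, y) \<in> R"
    then obtain b where "((x, y), b) \<in> C" using C(2) by auto
    then obtain \<alpha> where "F (\<lambda>i. (c ((x, y), b) i, \<alpha> i))" using F(2) by blast
    then show "\<exists>\<alpha>. G (\<lambda>i. (x i, y i, \<alpha> i))"
      unfolding G_def c_def by (intro exI[of _ "\<lambda>i. prod_encode (b i, \<alpha> i)"]) simp
  next
    assume "\<exists>\<alpha>. G (\<lambda>i. (x i, y i, \<alpha> i))"
    then obtain \<alpha> where "G (\<lambda>i. (x i, y i, \<alpha> i))" ..
    then have "F (\<lambda>i. (c ((x, y), \<lambda>i. fst (prod_decode (\<alpha> i))) i, snd (prod_decode (\<alpha> i))))"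
      unfolding G_def c_def by simp
    then have "((x, y), \<lambda>i. fst (prod_decode (\<alpha> i))) \<in> C"
      unfolding F(2) by (intro exI[of _ "\<lambda>i. snd (prod_decode (\<alpha> i))"])
    then show "(x, y) \<in> R" using C(2) by force
  qed
  show ?thesis
  \<comment> \<open>\<open>P\<close> accepts the initial segments of members of the closed set
    \<open>G\<close>.\<close>
  proof (intro exI[of _ "\<lambda>l. \<exists>g. G g \<and> l = map g [0..<length l]"] allI)
    fix x y
    show "(x, y) \<in> R \<longleftrightarrow> (\<exists>\<alpha>. \<forall>n. \<exists>g. G g \<and> map (\<lambda>i. (x i, y i, \<alpha> i)) [0..<n] =
        map g [0..<length (map (\<lambda>i. (x i, y i, \<alpha> i)) [0..<n])])"
      unfolding 1 by (subst seq_closed_iff[OF G]) simp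
  qed
qed

section \<open>Coding Polish spaces by bit sequences\<close>

lemma (in Metric_space) dense_sequence:
  assumes "separable_space mtopology" "M \<noteq> {}"
  shows "\<exists>q :: nat \<Rightarrow> 'a. range q \<subseteq> M \<and> (\<forall>x\<in>M. \<forall>r>0. \<exists>i. d x (q i) < r)"
proof -
  obtain C where C: "countable C" "C \<subseteq> M" "mtopology closure_of C = M"
    using assms unfolding separable_space_def by auto
  have "C \<noteq> {}" using C(3) assms(2) by auto
  then have ran: "range (from_nat_into C) = C" using C(1) by (rule range_from_nat_into)
  have "\<exists>i. d x (from_nat_into C i) < r" if x: "x \<in> M" and r: "0 < r" for x r
  proof -
    have "x \<in> mtopology closure_of C" using x C(3) by simp
    then obtain y where y: "y \<in> C" "y \<in> mball x r"
      using r unfolding metric_closure_of by blast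
    then obtain i where "y = from_nat_into C i" using ran by blast
    then show ?thesis using y(2) by auto
  qed
  then show ?thesis using ran C(2) by (intro exI[of _ "from_nat_into C"]) simp
qed

text \<open>The code of \<open>x\<close> lists the balls of radius \<open>1 / (k + 1)\<close> around the points of a dense sequence that contain
  \<open>x\<close>. A sequence of bits \<open>z\<close> determines the Cauchy candidate \<open>\<sigma> z\<close>, and whether its limit lies in such
  a ball is a Borel condition on \<open>z\<close>; so the codes are the \<open>z\<close> that agree with the code of the limit.\<close>

lemma (in Metric_space) polish_code:
  assumes "mcomplete" "separable_space mtopology" and Y: "space Y = M" "sets Y = sigma_sets M {U. openin mtopology U}"
    and ne: "M \<noteq> {}"
  obtains e :: "'a \<Rightarrow> nat \<Rightarrow> bool" where "e \<in> borel_measurable Y" "e ` M \<in> sets borel" "inj_on e M"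
    "inv_into M e \<in> measurable (restrict_space borel (e ` M)) Y"
proof -
  obtain q :: "nat \<Rightarrow> 'a" where q: "range q \<subseteq> M" "\<And>x r. x \<in> M \<Longrightarrow> 0 < r \<Longrightarrow> \<exists>i. d x (q i) < r"
    using dense_sequence[OF assms(2) ne] by blast
  have qM: "q i \<in> M" for i using q(1) by auto
  define r where "r k = inverse (real (Suc k))" for k
  have r0: "0 < r k" for k by (simp add: r_def)
  have rsmall: "\<exists>k. r k < \<epsilon>" if "0 < \<epsilon>" for \<epsilon>
    using reals_Archimedean[OF that] by (simp add: r_def)
  define e where "e x l = (case prod_decode l of (i, k) \<Rightarrow> d x (q i) < r k)" for x l
  have e: "e x (prod_encode (i, k)) \<longleftrightarrow> d x (q i) < r k" for x i k by (simp add: e_def)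
  \<comment> \<open>The \<open>n\<close>-th candidate is the first dense point whose ball of radius
    \<open>r n\<close> is listed by \<open>z\<close>. If \<open>z\<close> lists none,
    \<open>LEAST\<close> is unspecified, but \<open>B\<close> tests the resulting sequence
    itself.\<close>
  define \<sigma> where "\<sigma> z n = q (LEAST i. z (prod_encode (i, n)))" for z :: "nat \<Rightarrow> bool" and n
  have \<sigma>M: "\<sigma> z n \<in> M" for z n by (simp add: \<sigma>_def qM)
  \<comment> \<open>That the limit is closer than \<open>r k\<close> to \<open>q i\<close> is said
    in terms of the sequence alone: eventually its terms are closer by a fixed margin
    \<open>r m\<close>.\<close>
  define E where "E z i k \<longleftrightarrow> (\<exists>m N. \<forall>n\<ge>N. d (\<sigma> z n) (q i) < r k - r m)" for z i k
  define B where "B = {z. (\<forall>j. \<exists>N. \<forall>n\<ge>N. \<forall>n'\<ge>N. d (\<sigma> z n) (\<sigma> z n') < r j) \<and>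
                     (\<forall>i k. z (prod_encode (i, k)) \<longleftrightarrow> E z i k)}"
  have lim: "d x (q i) < r k \<longleftrightarrow> E z i k"
    if x: "x \<in> M" and conv: "\<And>\<epsilon>. 0 < \<epsilon> \<Longrightarrow> \<exists>N. \<forall>n\<ge>N. d (\<sigma> z n) x < \<epsilon>" for x z i k
  proof
    assume "d x (q i) < r k"
    then have pos: "0 < (r k - d x (q i)) / 2" by simp
    obtain m where m: "r m < (r k - d x (q i)) / 2" using rsmall[OF pos] by blast
    obtain N where N: "\<forall>n\<ge>N. d (\<sigma> z n) x < (r k - d x (q i)) / 2" using conv[OF pos] by blast
    have "d (\<sigma> z n) (q i) < r k - r m" if "n \<ge> N" for n
      using triangle[of "\<sigma> z n" x "q i"] N that m x qM \<sigma>M by (smt (verit) field_sum_of_halves)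
    then show "E z i k" unfolding E_def by blast
  next
    assume "E z i k"
    then obtain m N where 1: "\<forall>n\<ge>N. d (\<sigma> z n) (q i) < r k - r m" unfolding E_def by blast
    obtain N' where 2: "\<forall>n\<ge>N'. d (\<sigma> z n) x < r m" using conv[OF r0] by blast
    have "d (\<sigma> z (max N N')) (q i) < r k - r m" "d (\<sigma> z (max N N')) x < r m" using 1 2 by auto
    then show "d x (q i) < r k"
      using triangle[of x "\<sigma> z (max N N')" "q i"] commute[of x "\<sigma> z (max N N')"] x qM \<sigma>M by auto
  qed
  have image: "B = e ` M"
  proof (intro equalityI subsetI)
    fix z assume z: "z \<in> B"
    have "MCauchy (\<sigma> z)"
      unfolding MCauchy_def
    proof (intro conjI allI impI)
      fix \<epsilon> :: real assume "0 < \<epsilon>"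
      then obtain j where "r j < \<epsilon>" using rsmall by blast
      moreover obtain N where "\<forall>n\<ge>N. \<forall>n'\<ge>N. d (\<sigma> z n) (\<sigma> z n') < r j" using z unfolding B_def by blast
      ultimately show "\<exists>N. \<forall>n n'. N \<le> n \<longrightarrow> N \<le> n' \<longrightarrow> d (\<sigma> z n) (\<sigma> z n') < \<epsilon>"
        by (meson less_trans)
    qed (use \<sigma>M in auto)
    then obtain x where "limitin mtopology (\<sigma> z) x sequentially"
      using assms(1) unfolding mcomplete_def by blast
    then have x: "x \<in> M" "\<And>\<epsilon>. 0 < \<epsilon> \<Longrightarrow> \<exists>N. \<forall>n\<ge>N. d (\<sigma> z n) x < \<epsilon>"
      unfolding limit_metric_sequentially by (simp, meson)
    have "z (prod_encode (i, k)) = e x (prod_encode (i, k))" for i k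
      using lim[OF x, of i k] z unfolding B_def e by blast
    then have "z (prod_encode p) = e x (prod_encode p)" for p
      by (cases p) simp
    then have "z = e x" by (intro ext) (metis prod_decode_inverse)
    then show "z \<in> e ` M" using x(1) by (rule image_eqI)
  next
    fix z assume "z \<in> e ` M"
    then obtain x where x: "x \<in> M" "z = e x" by blast
    have near: "d (\<sigma> z n) x < r n" for n
    proof -
      have "\<exists>i. z (prod_encode (i, n))" using q(2)[OF x(1) r0] by (simp add: x(2) e)
      then have "z (prod_encode (LEAST i. z (prod_encode (i, n)), n))" by (rule LeastI_ex)
      then show ?thesis by (simp add: x(2) e \<sigma>_def commute)
    qed
    have conv: "\<exists>N. \<forall>n\<ge>N. d (\<sigma> z n) x < \<epsilon>" if "0 < \<epsilon>" for \<epsilon>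
    proof -
      obtain k where "r k < \<epsilon>" using rsmall \<open>0 < \<epsilon>\<close> by blast
      moreover have "r n \<le> r k" if "n \<ge> k" for n
        using that by (simp add: r_def field_simps)
      ultimately show ?thesis using near by (meson less_le_trans less_trans)
    qed
    have "\<exists>N. \<forall>n\<ge>N. \<forall>n'\<ge>N. d (\<sigma> z n) (\<sigma> z n') < r j" for j
    proof -
      have "0 < r j / 2" using r0 by simp
      then obtain N where N: "\<forall>n\<ge>N. d (\<sigma> z n) x < r j / 2" using conv by blast
      have "d (\<sigma> z n) (\<sigma> z n') < r j" if "n \<ge> N" "n' \<ge> N" for n n'
      proof -
        have "d (\<sigma> z n) x < r j / 2" "d (\<sigma> z n') x < r j / 2" using N that by auto
        then show ?thesis
          using triangle[of "\<sigma> z n" x "\<sigma> z n'"] commute[of x "\<sigma> z n'"] x(1) \<sigma>M by auto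
      qed
      then show ?thesis by blast
    qed
    moreover have "z (prod_encode (i, k)) \<longleftrightarrow> E z i k" for i k
      using lim[OF x(1) conv, of i k] unfolding x(2) e .
    ultimately show "z \<in> B" unfolding B_def by blast
  qed
  have coord: "Measurable.pred borel (\<lambda>z :: nat \<Rightarrow> bool. z l)" for l
    by (rule measurable_fun_discreteD)
  have cs: "{z. z l} \<in> sets (borel :: (nat \<Rightarrow> bool) measure)" for l
    using coord[of l] unfolding pred_def by simp
  have L: "(\<lambda>z. LEAST i. z (prod_encode (i, n))) \<in> measurable (borel :: (nat \<Rightarrow> bool) measure) (count_space UNIV)" for n
    by (rule measurable_Least) (rule coord)
  have \<sigma>meas: "(\<lambda>z. \<sigma> z n) \<in> measurable borel (count_space UNIV)" for n
    unfolding \<sigma>_def by (rule measurable_compose[OF L]) simp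
  have p1: "Measurable.pred borel (\<lambda>z. d (\<sigma> z n) (q i) < c)" for n i c
    by (rule measurable_compose[OF \<sigma>meas]) simp
  have p2: "Measurable.pred borel (\<lambda>z. d (\<sigma> z n) (\<sigma> z n') < c)" for n n' c
    unfolding \<sigma>_def
    by (rule measurable_compose_countable[OF _ L[of n]], rule measurable_compose[OF L[of n']]) simp
  have Bmeas: "B \<in> sets borel"
  proof -
    have "Measurable.pred borel (\<lambda>z. (\<forall>j. \<exists>N. \<forall>n\<ge>N. \<forall>n'\<ge>N. d (\<sigma> z n) (\<sigma> z n') < r j) \<and>
                     (\<forall>i k. z (prod_encode (i, k)) \<longleftrightarrow> E z i k))"
      unfolding E_def
      by (intro pred_intros_logic pred_intros_countable p1 p2 coord measurable_const) simp_all
    then show ?thesis unfolding B_def pred_def by (simp only: space_borel UNIV_I simp_thms)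
  qed
  have inj: "inj_on e M"
  proof (rule inj_onI, rule ccontr)
    fix x y assume xy: "x \<in> M" "y \<in> M" "e x = e y" "x \<noteq> y"
    then have "0 < d x y / 2" by simp
    then obtain k where k: "r k < d x y / 2" using rsmall by blast
    obtain i where i: "d x (q i) < r k" using q(2)[OF xy(1) r0] by blast
    then have "d y (q i) < r k" using xy(3) e by metis
    then show False using i k triangle[of x "q i" y] commute[of y "q i"] xy qM by auto
  qed
  have ball: "{x \<in> M. d x (q i) < r k} \<in> sets Y" for i k
  proof -
    have "{x \<in> M. d x (q i) < r k} = mball (q i) (r k)" using commute qM by auto
    then show ?thesis unfolding Y(2) by (auto intro: sigma_sets.Basic)
  qed
  have emeas: "e \<in> borel_measurable Y"
  proof (rule measurable_fun_discreteI)
    fix l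
    obtain i k where l: "l = prod_encode (i, k)" by (metis prod_decode_inverse surj_pair)
    show "(\<lambda>x. e x l) \<in> measurable Y (count_space UNIV)"
      unfolding pred_def l e using ball by (simp add: Y(1))
  qed
  have "inv_into M e \<in> measurable (restrict_space borel (e ` M)) Y"
  proof (rule measurable_sigma_sets[OF Y(2)])
    show "{U. openin mtopology U} \<subseteq> Pow M" using openin_subset by fastforce
    show "inv_into M e \<in> space (restrict_space borel (e ` M)) \<rightarrow> M"
      by (auto simp: space_restrict_space inv_into_into)
    fix U assume "U \<in> {U. openin mtopology U}"
    then have U: "U \<subseteq> M" "\<And>x. x \<in> U \<Longrightarrow> \<exists>s>0. mball x s \<subseteq> U" by (auto simp: openin_mtopology)
    \<comment> \<open>An open set is the union of the countably many coded balls inside it, so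
      membership is a countable disjunction of conditions on single bits of the code.\<close>
    have iff: "x \<in> U \<longleftrightarrow> (\<exists>i k. mball (q i) (r k) \<subseteq> U \<and> d x (q i) < r k)" if x: "x \<in> M" for x
    proof
      assume "x \<in> U"
      then obtain s where s: "0 < s" "mball x s \<subseteq> U" using U by blast
      then have "0 < s / 2" by simp
      then obtain k where k: "r k < s / 2" using rsmall by blast
      obtain i where i: "d x (q i) < r k" using q(2)[OF x r0] by blast
      have "mball (q i) (r k) \<subseteq> mball x s"
      proof
        fix y assume "y \<in> mball (q i) (r k)"
        then show "y \<in> mball x s" using i k triangle[of x "q i" y] x qM by auto
      qed
      then show "\<exists>i k. mball (q i) (r k) \<subseteq> U \<and> d x (q i) < r k" using i s(2) by blast
    next
      assume "\<exists>i k. mball (q i) (r k) \<subseteq> U \<and> d x (q i) < r k"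
      then show "x \<in> U" using x qM commute by auto
    qed
    have "inv_into M e -` U \<inter> space (restrict_space borel (e ` M)) =
        (\<Union>(i, k) \<in> {(i, k). mball (q i) (r k) \<subseteq> U}. {z. z (prod_encode (i, k))} \<inter> e ` M)"
      by (auto simp: space_restrict_space inv_into_f_f[OF inj] e iff) blast
    also have "\<dots> \<in> sets borel"
    proof (rule sets.countable_UN'')
      show "countable {(i, k). mball (q i) (r k) \<subseteq> U}" by (rule countableI_type)
      show "(case p of (i, k) \<Rightarrow> {z. z (prod_encode (i, k))} \<inter> e ` M) \<in> sets borel" for p
        using sets.Int[OF cs Bmeas] by (cases p) (simp add: image)
    qed
    finally show "inv_into M e -` U \<inter> space (restrict_space borel (e ` M)) \<in> sets (restrict_space borel (e ` M))"
      using Bmeas by (subst sets_restrict_space_iff) (simp_all add: image space_restrict_space)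
  qed
  from that[OF emeas Bmeas[unfolded image] inj this] show ?thesis .
qed

lemma standard_borel_code:
  assumes "standard_borel Y"
  obtains e :: "'b \<Rightarrow> nat \<Rightarrow> bool" where "e \<in> borel_measurable Y" "e ` space Y \<in> sets borel"
    "inj_on e (space Y)" "inv_into (space Y) e \<in> measurable (restrict_space borel (e ` space Y)) Y"
proof (cases "space Y = {}")
  \<comment> \<open>\<open>polish_code\<close> picks a dense sequence and so wants a point; over an
    empty space any map is a code, with empty image.\<close>
  case True
  show ?thesis
    by (rule that[of "\<lambda>_ _. False"]) (auto simp: True measurable_def space_restrict_space)
next
  case False
  obtain T where T: "completely_metrizable_space T" "separable_space T" "space Y = topspace T" "sets Y = sets (borel_of T)"
    using assms unfolding standard_borel_def polish_space_def by blast
  then obtain M d where Md: "Metric_space M d" "Metric_space.mcomplete M d" "T = Metric_space.mtopology M d"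
    unfolding completely_metrizable_space_def by blast
  interpret Metric_space M d by fact
  have Ysets: "sets Y = sigma_sets M {U. openin mtopology U}"
    unfolding T(4) borel_of_def Md(3) topspace_mtopology
    by (rule sets_measure_of) (use openin_subset in fastforce)
  have M: "space Y = M" using T(3) Md(3) by simp
  show ?thesis
  proof (rule polish_code[OF Md(2) T(2)[unfolded Md(3)] M Ysets])
    show "M \<noteq> {}" using False M by simp
  qed (rule that, simp_all add: M)
qed

section \<open>A rigid graph\<close>

text \<open>Adjacency lists of a graph on \<open>{0..<12}\<close> found by computer search: it is rigid, each vertex lies
  in a triangle, and for \<open>l < 3\<close> the pairs \<open>{3l, 3l + 1}\<close> and \<open>{3l + 1, 3l + 2}\<close> are independent and
  have no common neighbour; vertex 9 is not adjacent to 3, 4, 5.\<close>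

definition core_nbrs :: "nat list list" where
  "core_nbrs = [[3, 7, 9, 10], [5, 6, 11], [3, 8, 10], [0, 2, 7, 11], [6, 10], [1, 7, 11],
     [1, 4, 10, 11], [0, 3, 5], [2, 9, 10, 11], [0, 8, 10, 11], [0, 2, 4, 6, 8, 9], [1, 3, 5, 6, 8, 9]]"

definition core_adj :: "nat \<Rightarrow> nat \<Rightarrow> bool" where
  "core_adj i j \<longleftrightarrow> i < 12 \<and> j < 12 \<and> j \<in> set (core_nbrs ! i)"

text \<open>A list in \<open>ls\<close> holds the images of the vertices placed so far, and
  \<open>ps\<close> the positions of those adjacent to the next vertex.\<close>

definition extend_homs :: "nat list \<Rightarrow> nat list list \<Rightarrow> nat list list" where
  "extend_homs ps ls =
     concat (map (\<lambda>l. map (\<lambda>c. l @ [c]) (filter (\<lambda>c. list_all (\<lambda>p. c \<in> set (core_nbrs ! (l ! p))) ps) [0..<12])) ls)"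

text \<open>An order of the vertices that keeps the exhaustive search for endomorphisms small, with the positions
  of the earlier neighbours of each vertex.\<close>

definition core_order :: "nat list" where
  "core_order = [11, 8, 9, 10, 0, 2, 3, 7, 5, 1, 6, 4]"

definition core_back :: "nat list list" where
  "core_back = [[], [0], [0, 1], [1, 2], [2, 3], [1, 3], [0, 4, 5], [4, 6], [0, 7], [0, 8], [0, 3, 9], [3, 10]]"

lemma core_search: "fold extend_homs core_back [[]] = [core_order]"
  by code_simp

text \<open>By induction, the values of \<open>f\<close> on the first \<open>k\<close> vertices of
  \<open>core_order\<close> survive \<open>k\<close> steps of the search, and by
  \<open>core_search\<close> only the identity survives all twelve.\<close>

lemma core_rigid:
  assumes hom: "\<And>i j. core_adj i j \<Longrightarrow> core_adj (f i) (f j)" and bound: "\<And>i. i < 12 \<Longrightarrow> f i < 12"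
    and i: "i < 12"
  shows "f i = i"
proof -
  have step: "map f (l @ [v]) \<in> set (extend_homs ps ls)"
    if "map f l \<in> set ls" "v < 12" "list_all (\<lambda>p. p < length l \<and> core_adj (l ! p) v) ps" for l v ps ls
  proof -
    have "list_all (\<lambda>p. f v \<in> set (core_nbrs ! (map f l ! p))) ps"
      using that(3) hom unfolding list_all_iff by (auto simp: core_adj_def)
    then show ?thesis using that(1) bound[OF that(2)] unfolding extend_homs_def by auto
  qed
  have all: "map f (take k core_order) \<in> set (fold extend_homs (take k core_back) [[]])" if "k \<le> 12" for k
    using that
  proof (induction k)
    case (Suc k)
    have len: "length core_order = 12" "length core_back = 12" by (simp_all add: core_order_def core_back_def)
    have chk: "\<forall>k \<in> set [0..<12]. core_order ! k < 12 \<and>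
        list_all (\<lambda>p. p < k \<and> core_order ! k \<in> set (core_nbrs ! (core_order ! p)) \<and> core_order ! p < 12) (core_back ! k)"
      by code_simp
    have "list_all (\<lambda>p. p < length (take k core_order) \<and> core_adj (take k core_order ! p) (core_order ! k)) (core_back ! k)"
      "core_order ! k < 12"
      using chk Suc.prems len by (auto simp: list_all_iff core_adj_def)
    then have "map f (take k core_order @ [core_order ! k]) \<in>
        set (extend_homs (core_back ! k) (fold extend_homs (take k core_back) [[]]))"
      using Suc by (intro step) auto
    then show ?case
      using Suc.prems len by (simp add: take_Suc_conv_app_nth)
  qed simp
  have "map f core_order = core_order"
    using all[of 12] core_search by (simp add: core_order_def core_back_def)
  moreover have "i \<in> set core_order"
  proof -
    have "\<forall>i \<in> set [0..<12]. i \<in> set core_order" by code_simp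
    then show ?thesis using i by simp
  qed
  ultimately show ?thesis by (metis map_idI map_eq_conv list.map_id0 id_apply)
qed

lemma core_adj_sym: "core_adj i j \<Longrightarrow> core_adj j i"
proof -
  have "\<forall>i \<in> set [0..<12]. \<forall>j \<in> set (core_nbrs ! i). i \<in> set (core_nbrs ! j)" by code_simp
  then show "core_adj i j \<Longrightarrow> core_adj j i" by (auto simp: core_adj_def)
qed

lemma core_adj_irrefl: "\<not> core_adj i i"
proof -
  have "\<forall>i \<in> set [0..<12]. i \<notin> set (core_nbrs ! i)" by code_simp
  then show ?thesis by (auto simp: core_adj_def)
qed

lemma core_triangle:
  assumes "i < 12"
  shows "\<exists>j k. core_adj i j \<and> core_adj i k \<and> core_adj j k"
proof -
  have "\<forall>i \<in> set [0..<12]. \<exists>j \<in> set [0..<12]. j \<in> set (core_nbrs ! i) \<and>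
      (\<exists>k \<in> set [0..<12]. k \<in> set (core_nbrs ! i) \<and> k \<in> set (core_nbrs ! j))" by code_simp
  then show ?thesis using assms unfolding core_adj_def by force
qed

section \<open>Pairs of core vertices encoding levels and bits\<close>

definition anchor :: "nat \<Rightarrow> bool \<Rightarrow> nat" where
  "anchor n b = 3 * (n mod 3) + of_bool b"

text \<open>With \<open>l = n mod 3\<close>, bit \<open>False\<close> is coded by
  \<open>{3l, 3l + 1}\<close> and bit \<open>True\<close> by \<open>{3l + 1, 3l + 2}\<close>.
  Neither pair contains the other, so homomorphisms have to preserve both values.\<close>

definition colour :: "nat \<Rightarrow> bool \<Rightarrow> nat set" where
  "colour n b = {anchor n b, Suc (anchor n b)}"

lemma colour_less: "i \<in> colour n b \<Longrightarrow> i < 9"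
  by (cases b) (auto simp: colour_def anchor_def)

lemma colour_div: "i \<in> colour n b \<Longrightarrow> i div 3 = n mod 3"
  by (cases b) (auto simp: colour_def anchor_def)

lemma colour_disjoint: "i \<in> colour m b \<Longrightarrow> i \<in> colour n c \<Longrightarrow> m mod 3 = n mod 3"
  using colour_div by metis

lemma colour_inj:
  assumes "anchor m b \<in> colour n c" "Suc (anchor m b) \<in> colour n c"
  shows "m mod 3 = n mod 3 \<and> b = c"
proof -
  have "m mod 3 = n mod 3"
    using colour_disjoint[of "anchor m b" m b n c] assms(1) by (simp add: colour_def)
  moreover have "anchor m b = anchor n c" using assms by (auto simp: colour_def)
  ultimately show ?thesis by (cases b; cases c) (auto simp: anchor_def)
qed

lemma anchor_mem: "anchor n b \<in> set [0, 1, 3, 4, 6, 7]"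
proof -
  have "n mod 3 < 3" by simp
  then consider "n mod 3 = 0" | "n mod 3 = 1" | "n mod 3 = 2" by linarith
  then show ?thesis by cases (cases b; simp add: anchor_def)+
qed

text \<open>Hence a common neighbour of both vertices of a pair lies outside the core, which makes
  attached nodes recognisable.\<close>

lemma colour_no_common_nbr:
  assumes "core_adj (anchor n b) i" "core_adj (Suc (anchor n b)) i"
  shows False
proof -
  have "\<forall>a \<in> set [0, 1, 3, 4, 6, 7]. \<forall>i \<in> set (core_nbrs ! a). i \<notin> set (core_nbrs ! Suc a)" by code_simp
  from this[rule_format, OF anchor_mem[of n b]] show ?thesis using assms by (auto simp: core_adj_def)
qed

lemma colour_indep:
  assumes "i \<in> colour n b" "j \<in> colour n b"
  shows "\<not> core_adj i j"
proof -
  have "\<forall>a \<in> set [0, 1, 3, 4, 6, 7]. Suc a \<notin> set (core_nbrs ! a)" by code_simp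
  from this[rule_format, OF anchor_mem[of n b]] have "\<not> core_adj (anchor n b) (Suc (anchor n b))"
    by (auto simp: core_adj_def)
  then show ?thesis using assms core_adj_sym core_adj_irrefl unfolding colour_def by blast
qed

text \<open>Nodes of length 1 are attached both to vertex 9 and to a pair inside
  \<open>{3, 4, 5}\<close>; this keeps their attachments free of triangles.\<close>

lemma root_indep:
  assumes "i \<in> colour 1 b"
  shows "\<not> core_adj i 9"
proof -
  have "\<forall>i \<in> {3, 4, 5}. (9::nat) \<notin> set (core_nbrs ! i)" by code_simp
  moreover have "i \<in> {3, 4, 5}" using assms by (cases b) (auto simp: colour_def anchor_def)
  ultimately show ?thesis by (auto simp: core_adj_def)
qed

section \<open>The homomorphism order on trees of chains\<close>

type_synonym column = "(bool \<times> nat) list"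

text \<open>A node of length \<open>n\<close> over \<open>x\<close> is the restriction to \<open>{0..<n}\<close> of a chain
  \<open>z\<^sub>0, \<alpha>\<^sub>1, z\<^sub>1, \<dots>, \<alpha>\<^sub>k, z\<^sub>k = x\<close> of potential witnesses: column \<open>i\<close> lists the pairs
  \<open>(z\<^sub>j i, \<alpha>\<^sub>j\<^sub>+\<^sub>1 i)\<close> with \<open>j < k\<close>. Chains can be prolonged at the end by a witness of
  \<open>(x, y) \<in> R\<close>, which is why no normal form of the tree \<open>P\<close> with respect to transitivity is needed.\<close>

definition chain_bit :: "(nat \<Rightarrow> bool) \<Rightarrow> column list \<Rightarrow> nat \<Rightarrow> nat \<Rightarrow> bool" where
  "chain_bit x s j i = (if j < length (s ! i) then fst (s ! i ! j) else x i)"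

definition node :: "((bool \<times> bool \<times> nat) list \<Rightarrow> bool) \<Rightarrow> (nat \<Rightarrow> bool) \<Rightarrow> column list \<Rightarrow> bool" where
  "node P x s \<longleftrightarrow> s \<noteq> [] \<and> (\<forall>c \<in> set s. length c = length (hd s)) \<and>
     (\<forall>j < length (hd s). \<forall>m \<le> length s.
        P (map (\<lambda>i. (chain_bit x s j i, chain_bit x s (Suc j) i, snd (s ! i ! j))) [0..<m]))"

text \<open>Along a branch these bits spell out the first member \<open>z\<^sub>0\<close> of the
  chain.\<close>

definition node_bit :: "(nat \<Rightarrow> bool) \<Rightarrow> column list \<Rightarrow> bool" where
  "node_bit x s = chain_bit x s 0 (length s - 1)"

definition node_core :: "(nat \<Rightarrow> bool) \<Rightarrow> column list \<Rightarrow> nat set" where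
  "node_core x s = (if length s = 1 then {9} else {}) \<union> colour (length s) (node_bit x s)"

text \<open>Core vertices beyond 11 and words that are not nodes over \<open>x\<close> are isolated, so that all graphs
  live on the same countable type. Vertex 9 of the core serves as the root of the tree of nodes.\<close>

fun tree_adj :: "((bool \<times> bool \<times> nat) list \<Rightarrow> bool) \<Rightarrow> (nat \<Rightarrow> bool) \<Rightarrow>
    nat + column list \<Rightarrow> nat + column list \<Rightarrow> bool" where
  "tree_adj P x (Inl i) (Inl j) \<longleftrightarrow> core_adj i j"
| "tree_adj P x (Inl i) (Inr s) \<longleftrightarrow> node P x s \<and> i \<in> node_core x s"
| "tree_adj P x (Inr s) (Inl i) \<longleftrightarrow> node P x s \<and> i \<in> node_core x s"
| "tree_adj P x (Inr s) (Inr t) \<longleftrightarrow> node P x s \<and> node P x t \<and> (\<exists>c. t = s @ [c] \<or> s = t @ [c])"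

lemma tree_adj_sym: "tree_adj P x u v \<Longrightarrow> tree_adj P x v u"
  by (cases u; cases v) (auto simp: core_adj_sym)

lemma tree_adj_irrefl: "\<not> tree_adj P x u u"
  by (cases u) (auto simp: core_adj_irrefl)

lemma node_core_indep:
  assumes "i \<in> node_core x s" "j \<in> node_core x s"
  shows "\<not> core_adj i j"
proof -
  have "\<not> core_adj i 9 \<and> \<not> core_adj 9 i" if "i \<in> colour (Suc 0) b" for i b
    using root_indep[of i b] that core_adj_sym by auto
  then show ?thesis
    using assms by (auto simp: node_core_def core_adj_irrefl colour_indep split: if_splits)
qed

text \<open>Levels modulo 3 differ between a node and its child, so their pairs lie in different
  blocks, and vertex 9 is attached at length 1 only.\<close>

lemma node_core_child: "i \<in> node_core x s \<Longrightarrow> i \<notin> node_core x (s @ [c])"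
proof
  assume i: "i \<in> node_core x s" "i \<in> node_core x (s @ [c])"
  show False
  proof (cases "i = 9")
    case True
    then show False using i colour_less[of 9] unfolding node_core_def
      by (cases s) (auto split: if_splits)
  next
    case False
    then have "i \<in> colour (length s) (node_bit x s)" "i \<in> colour (length (s @ [c])) (node_bit x (s @ [c]))"
      using i unfolding node_core_def by (simp_all split: if_splits)
    from colour_disjoint[OF this] show False by simp presburger
  qed
qed

text \<open>A triangle through a node would contain two adjacent core vertices attached to that
  node, or a node and its child attached to one core vertex, or three nodes any two of which are
  parent and child, which their lengths exclude.\<close>

lemma triangle_in_core:
  assumes "tree_adj P x u v" "tree_adj P x v w" "tree_adj P x u w"
  shows "\<exists>i < 12. u = Inl i"
proof (cases u)
  case (Inl i)
  show ?thesis
  proof (cases "i < 12")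
    case False
    then have "i \<notin> node_core x s" for s
      using colour_less[of i] unfolding node_core_def by (auto split: if_splits)
    then show ?thesis using assms(1) False Inl by (cases v) (auto simp: core_adj_def)
  qed (use Inl in simp)
next
  case (Inr s)
  have "False"
  proof (cases v)
    case v: (Inl i)
    show False
    proof (cases w)
      case (Inl j)
      then show False using assms Inr v node_core_indep by auto
    next
      case (Inr r)
      then show False using assms v \<open>u = Inr s\<close> node_core_child by auto
    qed
  next
    case v: (Inr t)
    show False
    proof (cases w)
      case (Inl i)
      then show False using assms Inr v node_core_child by auto
    next
      case (Inr r)
      then show False using assms v \<open>u = Inr s\<close> by (auto dest: arg_cong[where f = length])
    qed
  qed
  then show ?thesis ..
qed

section \<open>Homomorphisms between trees of chains\<close>

text \<open>Prolongs a chain by one step: its endpoint \<open>x\<close>, implicit so far, is written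
  into the columns next to \<open>\<alpha>\<close>.\<close>

definition append_column :: "(nat \<Rightarrow> bool) \<Rightarrow> (nat \<Rightarrow> nat) \<Rightarrow> column list \<Rightarrow> column list" where
  "append_column x \<alpha> s = map (\<lambda>i. s ! i @ [(x i, \<alpha> i)]) [0..<length s]"

lemma chain_bit_append:
  assumes "i < length s" "j \<le> length (s ! i)"
  shows "chain_bit y (append_column x \<alpha> s) j i = chain_bit x s j i"
  using assms unfolding chain_bit_def append_column_def by (auto simp: nth_append)

text \<open>For \<open>j < k\<close> the conditions are those of \<open>s\<close>; the new one,
  \<open>j = k\<close>, is the assumption on \<open>\<alpha>\<close>.\<close>

lemma node_append:
  assumes s: "node P x s" and \<alpha>: "\<And>n. P (map (\<lambda>i. (x i, y i, \<alpha> i)) [0..<n])"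
  shows "node P y (append_column x \<alpha> s)"
proof -
  let ?t = "append_column x \<alpha> s"
  define k where "k = length (hd s)"
  have ne: "s \<noteq> []" and eq: "\<forall>c \<in> set s. length c = length (hd s)" using s unfolding node_def by blast+
  have len: "length (s ! i) = k" if "i < length s" for i using eq that by (simp add: k_def)
  have tlen: "length ?t = length s" by (simp add: append_column_def)
  have tnth: "?t ! i = s ! i @ [(x i, \<alpha> i)]" if "i < length s" for i
    using that by (simp add: append_column_def)
  have hd: "length (hd ?t) = Suc k"
  proof -
    have "?t \<noteq> []" using ne tlen by (metis length_0_conv)
    then show ?thesis using ne tnth[of 0] len[of 0] by (simp add: hd_conv_nth)
  qed
  show ?thesis
    unfolding node_def
  proof (intro conjI ballI allI impI)
    show "?t \<noteq> []" using ne tlen by auto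
    show "length c = length (hd ?t)" if "c \<in> set ?t" for c
      using that len unfolding hd unfolding append_column_def by auto
    fix j m assume j: "j < length (hd ?t)" and m: "m \<le> length ?t"
    show "P (map (\<lambda>i. (chain_bit y ?t j i, chain_bit y ?t (Suc j) i, snd (?t ! i ! j))) [0..<m])"
    proof (cases "j < k")
      case True
      have "map (\<lambda>i. (chain_bit y ?t j i, chain_bit y ?t (Suc j) i, snd (?t ! i ! j))) [0..<m] =
          map (\<lambda>i. (chain_bit x s j i, chain_bit x s (Suc j) i, snd (s ! i ! j))) [0..<m]"
      proof (rule map_cong[OF refl])
        fix i assume "i \<in> set [0..<m]"
        then have "i < length s" using m tlen by simp
        then show "(chain_bit y ?t j i, chain_bit y ?t (Suc j) i, snd (?t ! i ! j)) =
            (chain_bit x s j i, chain_bit x s (Suc j) i, snd (s ! i ! j))"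
          using True by (simp add: chain_bit_append len tnth nth_append)
      qed
      moreover have "P (map (\<lambda>i. (chain_bit x s j i, chain_bit x s (Suc j) i, snd (s ! i ! j))) [0..<m])"
        using s True m unfolding node_def k_def tlen by blast
      ultimately show ?thesis by (simp only:)
    next
      case False
      then have jk: "j = k" using j hd by simp
      have "map (\<lambda>i. (chain_bit y ?t j i, chain_bit y ?t (Suc j) i, snd (?t ! i ! j))) [0..<m] =
          map (\<lambda>i. (x i, y i, \<alpha> i)) [0..<m]"
      proof (rule map_cong[OF refl])
        fix i assume "i \<in> set [0..<m]"
        then have "i < length s" using m tlen by simp
        then show "(chain_bit y ?t j i, chain_bit y ?t (Suc j) i, snd (?t ! i ! j)) = (x i, y i, \<alpha> i)"
          using jk by (simp add: chain_bit_def len tnth nth_append)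
      qed
      then show ?thesis using \<alpha> by (simp only:)
    qed
  qed
qed

text \<open>Prolonging at the end leaves \<open>z\<^sub>0\<close> alone; if there were no steps, it
  turns from the implicit endpoint into explicit entries with the same bits.\<close>

lemma node_core_append:
  assumes "s \<noteq> []"
  shows "node_core y (append_column x \<alpha> s) = node_core x s"
proof -
  have "node_bit y (append_column x \<alpha> s) = node_bit x s"
    using assms chain_bit_append[of "length s - 1" s 0] unfolding node_bit_def
    by (simp add: append_column_def)
  then show ?thesis unfolding node_core_def by (simp add: append_column_def)
qed

lemma append_column_snoc:
  "append_column x \<alpha> (s @ [c]) = append_column x \<alpha> s @ [c @ [(x (length s), \<alpha> (length s))]]"
  by (simp add: append_column_def nth_append)

text \<open>The core stays fixed while every node is prolonged by the witness; words that are not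
  nodes are isolated and impose nothing.\<close>

lemma tree_hom_if:
  assumes \<alpha>: "\<And>n. P (map (\<lambda>i. (x i, y i, \<alpha> i)) [0..<n])"
  shows "\<exists>f. \<forall>u v. tree_adj P x u v \<longrightarrow> tree_adj P y (f u) (f v)"
proof (intro exI allI impI)
  fix u v assume uv: "tree_adj P x u v"
  have ne: "node P x s \<Longrightarrow> s \<noteq> []" for s by (simp add: node_def)
  show "tree_adj P y (map_sum id (append_column x \<alpha>) u) (map_sum id (append_column x \<alpha>) v)"
    using uv by (cases u; cases v)
      (auto simp: node_append[where P = P and x = x and y = y and \<alpha> = \<alpha>, OF _ \<alpha>] node_core_append ne append_column_snoc)
qed

text \<open>Triangles go to triangles, so the core is mapped into itself, and rigidity does the
  rest.\<close>

lemma tree_hom_core: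
  assumes hom: "\<And>u v. tree_adj P x u v \<Longrightarrow> tree_adj P y (f u) (f v)" and i: "i < 12"
  shows "f (Inl i) = Inl i"
proof -
  have "\<exists>j < 12. f (Inl i) = Inl j" if "i < 12" for i
  proof -
    obtain j k where "core_adj i j" "core_adj i k" "core_adj j k" using core_triangle[OF \<open>i < 12\<close>] by blast
    then show ?thesis
      by (intro triangle_in_core[of P y "f (Inl i)" "f (Inl j)" "f (Inl k)"] hom) simp_all
  qed
  then obtain g where g: "\<And>i. i < 12 \<Longrightarrow> g i < 12 \<and> f (Inl i) = Inl (g i)" by metis
  have "g i = i"
  proof (rule core_rigid[OF _ _ i])
    fix i j assume ij: "core_adj i j"
    then have "tree_adj P y (f (Inl i)) (f (Inl j))" by (intro hom) simp
    moreover have "i < 12" "j < 12" using ij by (auto simp: core_adj_def)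
    ultimately show "core_adj (g i) (g j)" using g by simp
  qed (use g in blast)
  then show ?thesis using g[OF i] by simp
qed

text \<open>Adjacency to a whole pair reveals a node together with its level modulo 3 and its bit,
  and a homomorphism fixing the core preserves such adjacency.\<close>

lemma colour_common_nbr:
  assumes "tree_adj P y (Inl (anchor n b)) w" "tree_adj P y (Inl (Suc (anchor n b))) w"
  shows "\<exists>t. w = Inr t \<and> node P y t \<and> length t mod 3 = n mod 3 \<and> node_bit y t = b"
proof (cases w)
  case (Inl i)
  then show ?thesis using assms colour_no_common_nbr by auto
next
  case (Inr t)
  have "anchor n b < 9" "Suc (anchor n b) < 9"
    using colour_less[of "anchor n b" n b] colour_less[of "Suc (anchor n b)" n b] by (simp_all add: colour_def)
  then have "anchor n b \<in> colour (length t) (node_bit y t)" "Suc (anchor n b) \<in> colour (length t) (node_bit y t)"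
    using assms Inr by (auto simp: node_core_def split: if_splits)
  from colour_inj[OF this] show ?thesis using assms Inr by simp
qed

text \<open>The nodes with empty columns (\<open>k = 0\<close>) form a branch over \<open>x\<close> itself, which a homomorphism has to
  carry to a branch over \<open>y\<close> with the same bits.\<close>

lemma tree_hom_branch:
  assumes hom: "\<And>u v. tree_adj P x u v \<Longrightarrow> tree_adj P y (f u) (f v)"
  shows "\<exists>d. \<forall>n. node P y (map d [0..<Suc n]) \<and> node_bit y (map d [0..<Suc n]) = x n"
proof -
  define s where "s n = replicate (Suc n) ([] :: column)" for n
  have s: "node P x (s n)" "length (s n) = Suc n" for n
    by (auto simp: node_def s_def)
  have sS: "s (Suc n) = s n @ [[]]" for n by (simp add: s_def replicate_append_same)
  have sbit: "node_bit x (s n) = x n" for n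
    unfolding node_bit_def chain_bit_def s_def by (simp del: replicate_Suc)
  have img: "\<exists>t. f (Inr (s n)) = Inr t \<and> node P y t \<and> length t mod 3 = Suc n mod 3 \<and> node_bit y t = x n" for n
  proof -
    have "tree_adj P y (f (Inl i)) (f (Inr (s n)))" if "i \<in> colour (Suc n) (x n)" for i
      by (rule hom) (use that s sbit in \<open>auto simp: node_core_def\<close>)
    moreover have "i < 12" if "i \<in> colour (Suc n) (x n)" for i using colour_less[OF that] by simp
    ultimately have "tree_adj P y (Inl i) (f (Inr (s n)))" if "i \<in> colour (Suc n) (x n)" for i
      using that tree_hom_core[of P x y f i] hom by metis
    then show ?thesis by (intro colour_common_nbr) (auto simp: colour_def)
  qed
  then obtain t where t: "\<And>n. f (Inr (s n)) = Inr (t n)" "\<And>n. node P y (t n)"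
    "\<And>n. length (t n) mod 3 = Suc n mod 3" "\<And>n. node_bit y (t n) = x n" by metis
  \<comment> \<open>The only nodes adjacent to vertex 9 are those of length 1, so the image starts
    at the root.\<close>
  have t0: "length (t 0) = 1"
  proof -
    have "tree_adj P y (f (Inl 9)) (f (Inr (s 0)))"
      by (rule hom) (use s in \<open>auto simp: node_core_def\<close>)
    then have "9 \<in> node_core y (t 0)" using tree_hom_core[of P x y f 9] hom t(1) by simp
    then show ?thesis using colour_less[of 9] unfolding node_core_def by (auto split: if_splits)
  qed
  \<comment> \<open>An edge leads to a child or to the parent. The parent of \<open>t 0\<close>
    would be empty, and the parent of a later node has the wrong length modulo 3.\<close>
  have tS: "length (t n) = Suc n \<and> (\<exists>c. t (Suc n) = t n @ [c])" for n
  proof (induction n)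
    case 0
    have "tree_adj P y (f (Inr (s 0))) (f (Inr (s (Suc 0))))"
      by (rule hom) (unfold tree_adj.simps, use s sS in blast)
    then obtain c where "t (Suc 0) = t 0 @ [c] \<or> t 0 = t (Suc 0) @ [c]" using t(1) by auto
    moreover have "t (Suc 0) \<noteq> []" using t(2) by (simp add: node_def)
    ultimately show ?case using t0 by auto
  next
    case (Suc n)
    have "tree_adj P y (f (Inr (s (Suc n)))) (f (Inr (s (Suc (Suc n)))))"
      by (rule hom) (unfold tree_adj.simps, use s sS in blast)
    then obtain c where "t (Suc (Suc n)) = t (Suc n) @ [c] \<or> t (Suc n) = t (Suc (Suc n)) @ [c]" using t(1) by auto
    moreover have "t (Suc n) \<noteq> t (Suc (Suc n)) @ [c]"
    proof
      assume "t (Suc n) = t (Suc (Suc n)) @ [c]"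
      then have "length (t (Suc (Suc n))) = Suc n" using Suc by auto
      then show False using t(3)[of "Suc (Suc n)"] by presburger
    qed
    ultimately show ?case using Suc by auto
  qed
  \<comment> \<open>The nodes \<open>t n\<close> extend one another, so their last columns form one
    infinite sequence of columns.\<close>
  have prefix: "map (\<lambda>i. last (t i)) [0..<Suc n] = t n" for n
  proof (induction n)
    case 0
    then show ?case using t0 by (cases "t 0") auto
  next
    case (Suc n)
    obtain c where "t (Suc n) = t n @ [c]" using tS by blast
    then have "t n @ [last (t (Suc n))] = t (Suc n)" by simp
    moreover have "map (\<lambda>i. last (t i)) [0..<Suc (Suc n)] = map (\<lambda>i. last (t i)) [0..<Suc n] @ [last (t (Suc n))]"
      by simp
    ultimately show ?case unfolding Suc by simp
  qed
  show ?thesis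
    by (rule exI[of _ "\<lambda>i. last (t i)"]) (simp only: prefix t(2,4) simp_thms)
qed

lemma tree_hom_iff:
  assumes P: "\<And>x y. (x, y) \<in> R \<longleftrightarrow> (\<exists>\<alpha>. \<forall>n. P (map (\<lambda>i. (x i, y i, \<alpha> i)) [0..<n]))"
    and R: "preorder_on B R" and "x \<in> B" "y \<in> B"
  shows "(\<exists>f. \<forall>u v. tree_adj P x u v \<longrightarrow> tree_adj P y (f u) (f v)) \<longleftrightarrow> (x, y) \<in> R"
proof
  assume "(x, y) \<in> R"
  then show "\<exists>f. \<forall>u v. tree_adj P x u v \<longrightarrow> tree_adj P y (f u) (f v)" using tree_hom_if P by metis
next
  assume "\<exists>f. \<forall>u v. tree_adj P x u v \<longrightarrow> tree_adj P y (f u) (f v)"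
  then obtain f where "\<And>u v. tree_adj P x u v \<Longrightarrow> tree_adj P y (f u) (f v)" by blast
  from tree_hom_branch[of P x y f, OF this] obtain d where d: "\<And>n. node P y (map d [0..<Suc n])"
    "\<And>n. node_bit y (map d [0..<Suc n]) = x n" by blast
  define k where "k = length (d 0)"
  have hd: "hd (map d [0..<Suc n]) = d 0" for n by (simp add: upt_conv_Cons del: upt_Suc)
  \<comment> \<open>The columns of a node are equally high and all prefixes share
    \<open>d 0\<close>, so the number \<open>k\<close> of steps is constant along the
    branch.\<close>
  have len: "length (d n) = k" for n
  proof -
    have "d n \<in> set (map d [0..<Suc n])" by simp
    then show ?thesis using d(1)[of n] unfolding node_def hd k_def by blast
  qed
  define z where "z j i = (if j < length (d i) then fst (d i ! j) else y i)" for j i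
  have chain: "chain_bit y (map d [0..<Suc n]) j i = z j i" if "i < Suc n" for n j i
    using that unfolding chain_bit_def z_def by (simp del: upt_Suc)
  have z0: "z 0 = x"
    using d(2) chain unfolding node_bit_def by (intro ext) (simp del: upt_Suc)
  have zk: "z k = y" by (simp add: z_def len fun_eq_iff)
  have step: "(z j, z (Suc j)) \<in> R" if j: "j < k" for j
    unfolding P
  proof (intro exI allI)
    fix n
    \<comment> \<open>Nodes are nonempty, so the condition at length \<open>n\<close> is read off
      the prefix of length \<open>Suc n\<close>.\<close>
    let ?s = "map d [0..<Suc n]"
    have "map (\<lambda>i. (chain_bit y ?s j i, chain_bit y ?s (Suc j) i, snd (?s ! i ! j))) [0..<n] =
        map (\<lambda>i. (z j i, z (Suc j) i, snd (d i ! j))) [0..<n]"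
      using chain by (simp del: upt_Suc)
    moreover have "P (map (\<lambda>i. (chain_bit y ?s j i, chain_bit y ?s (Suc j) i, snd (?s ! i ! j))) [0..<n])"
    proof -
      have "j < length (hd ?s)" using j unfolding hd k_def .
      moreover have "n \<le> length ?s" by simp
      ultimately show ?thesis using d(1)[of n] unfolding node_def by blast
    qed
    ultimately show "P (map (\<lambda>i. (z j i, z (Suc j) i, snd (d i ! j))) [0..<n])"
      by (simp only:)
  qed
  have "j \<le> k \<Longrightarrow> (x, z j) \<in> R" for j
  proof (induction j)
    case 0
    then show ?case using R \<open>x \<in> B\<close> z0 by (simp add: preorder_on_def refl_on_def)
  next
    case (Suc j)
    then have "(x, z j) \<in> R" "(z j, z (Suc j)) \<in> R" using step by auto
    then show ?case using R unfolding preorder_on_def by (blast dest: transD)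
  qed
  from this[of k] show "(x, y) \<in> R" using zk by simp
qed

section \<open>Graphs with definable labels\<close>

lemma borel_cylinder_induct:
  fixes S :: "('i::countable \<Rightarrow> bool) set set"
  assumes "sigma_algebra UNIV S" and cyl: "\<And>i. {g. g i} \<in> S" and "A \<in> sets borel"
  shows "A \<in> S"
proof -
  define M where "M = sigma UNIV S"
  have M: "sets M = S" "space M = UNIV"
    unfolding M_def using assms(1) by (auto simp: sigma_algebra.sigma_sets_eq)
  have "(\<lambda>g. g) \<in> borel_measurable M"
    by (rule measurable_fun_discreteI) (simp add: pred_def M cyl)
  from measurable_sets[OF this assms(3)] show ?thesis by (simp add: M)
qed

definition leaf :: "(nat \<times> nat \<Rightarrow> bool) \<Rightarrow> nat \<Rightarrow> bool" where
  "leaf H v \<longleftrightarrow> (\<exists>w. H (v, w) \<and> (\<forall>w'. H (v, w') \<longrightarrow> w' = w))"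

definition branching :: "(nat \<times> nat \<Rightarrow> bool) \<Rightarrow> nat \<Rightarrow> bool" where
  "branching H v \<longleftrightarrow> (\<exists>w w'. w \<noteq> w' \<and> H (v, w) \<and> H (v, w'))"

definition isolated :: "(nat \<times> nat \<Rightarrow> bool) \<Rightarrow> nat \<Rightarrow> bool" where
  "isolated H v \<longleftrightarrow> (\<forall>w. \<not> H (v, w))"

text \<open>The shift by one gives label 0 a leaf as well. As \<open>card\<close> of an infinite set
  is 0, a vertex with infinitely many leaves has no label.\<close>

definition label :: "(nat \<times> nat \<Rightarrow> bool) \<Rightarrow> nat \<Rightarrow> nat \<Rightarrow> bool" where
  "label H v n \<longleftrightarrow> branching H v \<and> card {w. H (v, w) \<and> leaf H w} = Suc n"

text \<open>An isomorphism invariant: labels replace vertices, and numbers that label nothing are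
  isolated.\<close>

definition label_graph :: "(nat \<times> nat \<Rightarrow> bool) \<Rightarrow> nat \<times> nat \<Rightarrow> bool" where
  "label_graph H = (\<lambda>(i, j). \<exists>v w. label H v i \<and> label H w j \<and> H (v, w))"

text \<open>The clause on leaves excludes components that are single edges. Branching neighbours are
  the targets onto which leaves are folded, and unique labels make \<open>label_graph\<close> a copy
  of the graph on the branching vertices, up to isolated ones.\<close>

definition labelled :: "(nat \<times> nat \<Rightarrow> bool) \<Rightarrow> bool" where
  "labelled H \<longleftrightarrow> H \<in> graphs \<and> infinite {v. isolated H v} \<and>
     (\<forall>v w. H (v, w) \<and> leaf H v \<longrightarrow> branching H w) \<and>
     (\<forall>v. branching H v \<longrightarrow> (\<exists>n. label H v n) \<and> (\<exists>w. branching H w \<and> H (v, w))) \<and>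
     (\<forall>n v w. label H v n \<and> label H w n \<longrightarrow> v = w)"

section \<open>Formulas defining labels\<close>

definition fm_and :: "fm \<Rightarrow> fm \<Rightarrow> fm" where
  "fm_and p q = Conj (\<lambda>k. if k = 0 then p else q)"

definition fm_imp :: "fm \<Rightarrow> fm \<Rightarrow> fm" where
  "fm_imp p q = Disj (\<lambda>k. if k = 0 then Neg p else q)"

definition fm_true :: fm where
  "fm_true = All 0 (Eq 0 0)"

lemma sat_connectives [simp]:
  "sat H (fm_and p q) v \<longleftrightarrow> sat H p v \<and> sat H q v"
  "sat H (fm_imp p q) v \<longleftrightarrow> (sat H p v \<longrightarrow> sat H q v)"
  "sat H fm_true v"
  by (auto simp: fm_and_def fm_imp_def fm_true_def)

lemma free_vars_connectives [simp]:
  "free_vars (fm_and p q) = free_vars p \<union> free_vars q"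
  "free_vars (fm_imp p q) = free_vars p \<union> free_vars q"
  "free_vars fm_true = {}"
  by (auto simp: fm_and_def fm_imp_def fm_true_def split: if_splits)

definition fm_leaf :: "nat \<Rightarrow> fm" where
  "fm_leaf a = Ex (a + 1) (fm_and (Adj a (a + 1)) (All (a + 2) (fm_imp (Adj a (a + 2)) (Eq (a + 2) (a + 1)))))"

definition fm_branching :: "nat \<Rightarrow> fm" where
  "fm_branching a = Ex (a + 1) (Ex (a + 2) (fm_and (Neg (Eq (a + 1) (a + 2))) (fm_and (Adj a (a + 1)) (Adj a (a + 2)))))"

definition fm_isolated :: "nat \<Rightarrow> fm" where
  "fm_isolated a = All (a + 1) (Neg (Adj a (a + 1)))"

lemma sat_fm_leaf [simp]: "sat H (fm_leaf a) v \<longleftrightarrow> leaf H (v a)"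
  by (simp add: fm_leaf_def leaf_def)

lemma free_vars_fm_leaf [simp]: "free_vars (fm_leaf a) = {a}"
  by (auto simp: fm_leaf_def)

lemma sat_fm_branching [simp]: "sat H (fm_branching a) v \<longleftrightarrow> branching H (v a)"
  by (simp add: fm_branching_def branching_def)

lemma free_vars_fm_branching [simp]: "free_vars (fm_branching a) = {a}"
  by (auto simp: fm_branching_def)

lemma sat_fm_isolated [simp]: "sat H (fm_isolated a) v \<longleftrightarrow> isolated H (v a)"
  by (simp add: fm_isolated_def isolated_def)

lemma free_vars_fm_isolated [simp]: "free_vars (fm_isolated a) = {a}"
  by (auto simp: fm_isolated_def)

text \<open>There are \<open>n\<close> witnesses of \<open>\<psi> a\<close> distinct from the values of the \<open>k\<close> variables following \<open>a\<close>.\<close>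

primrec fm_at_least :: "(nat \<Rightarrow> nat \<Rightarrow> fm) \<Rightarrow> nat \<Rightarrow> nat \<Rightarrow> nat \<Rightarrow> fm" where
  "fm_at_least \<psi> a 0 k = fm_true"
| "fm_at_least \<psi> a (Suc n) k = Ex (Suc a + k)
     (fm_and (Conj (\<lambda>c. if c < k then Neg (Eq (Suc a + k) (Suc a + c)) else fm_true))
        (fm_and (\<psi> a (Suc a + k)) (fm_at_least \<psi> a n (Suc k))))"

definition at_least :: "nat \<Rightarrow> 'a set \<Rightarrow> bool" where
  "at_least n X \<longleftrightarrow> (\<exists>Z \<subseteq> X. finite Z \<and> card Z = n)"

lemma at_least_Suc: "at_least (Suc n) X \<longleftrightarrow> (\<exists>x \<in> X. at_least n (X - {x}))"
proof
  assume "at_least (Suc n) X"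
  then obtain Z where Z: "Z \<subseteq> X" "finite Z" "card Z = Suc n" unfolding at_least_def by blast
  then obtain x where "x \<in> Z" by force
  then show "\<exists>x \<in> X. at_least n (X - {x})"
    using Z unfolding at_least_def by (intro bexI[of _ x] exI[of _ "Z - {x}"]) auto
next
  assume "\<exists>x \<in> X. at_least n (X - {x})"
  then obtain x Z where "x \<in> X" "Z \<subseteq> X - {x}" "finite Z" "card Z = n" unfolding at_least_def by blast
  then show "at_least (Suc n) X"
    unfolding at_least_def by (intro exI[of _ "insert x Z"]) (auto simp: card_insert_if)
qed

lemma at_least_card:
  assumes "finite X"
  shows "at_least n X \<longleftrightarrow> n \<le> card X"
  using assms obtain_subset_with_card_n[of n X] card_mono[of X] unfolding at_least_def by metis

lemma infinite_at_least: "infinite X \<longleftrightarrow> (\<forall>n. at_least n X)"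
proof
  assume "infinite X"
  then show "\<forall>n. at_least n X" using infinite_arbitrarily_large unfolding at_least_def by metis
next
  assume *: "\<forall>n. at_least n X"
  show "infinite X"
    using *[rule_format, of "Suc (card X)"] at_least_card[of X] by auto
qed

lemma card_eq_Suc_at_least: "card X = Suc n \<longleftrightarrow> at_least (Suc n) X \<and> \<not> at_least (Suc (Suc n)) X"
proof (cases "finite X")
  case True
  then show ?thesis by (auto simp: at_least_card)
next
  case False
  then have "at_least (Suc (Suc n)) X" using infinite_at_least by blast
  then show ?thesis using False by simp
qed

text \<open>The subtracted set consists of the witnesses chosen so far, kept in the variables after
  \<open>a\<close>; \<open>k = 0\<close> is the plain counting statement.\<close>

lemma sat_fm_at_least:
  assumes "\<And>b v. a < b \<Longrightarrow> sat H (\<psi> a b) v \<longleftrightarrow> Q (v a) (v b)"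
  shows "sat H (fm_at_least \<psi> a n k) v \<longleftrightarrow> at_least n ({w. Q (v a) w} - v ` {Suc a..<Suc a + k})"
proof (induction n arbitrary: k v)
  case 0
  then show ?case by (auto simp: at_least_def intro: exI[of _ "{}"])
next
  case (Suc n)
  let ?b = "Suc a + k"
  have "sat H (fm_at_least \<psi> a (Suc n) k) v \<longleftrightarrow>
      (\<exists>x. (\<forall>c<k. x \<noteq> v (Suc a + c)) \<and> Q (v a) x \<and> sat H (fm_at_least \<psi> a n (Suc k)) (v(?b := x)))"
    using assms by (auto cong: conj_cong split: if_splits)
  also have "\<dots> \<longleftrightarrow> (\<exists>x. x \<in> {w. Q (v a) w} - v ` {Suc a..<Suc a + k} \<and>
       at_least n ({w. Q (v a) w} - v ` {Suc a..<Suc a + k} - {x}))"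
  proof (rule iff_exI)
    fix x
    have "(v(?b := x)) ` {Suc a..<Suc a + Suc k} = insert x (v ` {Suc a..<Suc a + k})"
      by (auto simp: image_iff atLeastLessThanSuc)
    moreover have "(\<forall>c<k. x \<noteq> v (Suc a + c)) \<longleftrightarrow> x \<notin> v ` {Suc a..<Suc a + k}"
    proof -
      have "\<exists>c<k. x = v (Suc a + c)" if "x \<in> v ` {Suc a..<Suc a + k}"
      proof -
        obtain i where "Suc a \<le> i" "i < Suc a + k" "x = v i" using \<open>x \<in> v ` _\<close> by auto
        then show ?thesis by (intro exI[of _ "i - Suc a"]) simp
      qed
      then show ?thesis by auto
    qed
    moreover have "{w. Q (v a) w} - insert x (v ` {Suc a..<Suc a + k}) = {w. Q (v a) w} - v ` {Suc a..<Suc a + k} - {x}" by blast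
    ultimately show "((\<forall>c<k. x \<noteq> v (Suc a + c)) \<and> Q (v a) x \<and> sat H (fm_at_least \<psi> a n (Suc k)) (v(?b := x))) \<longleftrightarrow>
      (x \<in> {w. Q (v a) w} - v ` {Suc a..<Suc a + k} \<and>
       at_least n ({w. Q (v a) w} - v ` {Suc a..<Suc a + k} - {x}))"
      by (simp add: Suc.IH) blast
  qed
  also have "\<dots> \<longleftrightarrow> at_least (Suc n) ({w. Q (v a) w} - v ` {Suc a..<Suc a + k})"
    unfolding at_least_Suc by blast
  finally show ?case .
qed

lemma free_vars_fm_at_least:
  assumes "\<And>b. free_vars (\<psi> a b) \<subseteq> {a, b}"
  shows "free_vars (fm_at_least \<psi> a n k) \<subseteq> {a..<Suc a + k}"
proof (induction n arbitrary: k)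
  case (Suc n)
  have "free_vars (fm_at_least \<psi> a n (Suc k)) \<subseteq> {a..<Suc a + Suc k}" by (rule Suc)
  moreover have "free_vars (\<psi> a (Suc a + k)) \<subseteq> {a, Suc a + k}" by (rule assms)
  ultimately show ?case by (auto split: if_splits)
qed simp

definition fm_label :: "nat \<Rightarrow> nat \<Rightarrow> fm" where
  "fm_label a n = (let \<psi> = \<lambda>a b. fm_and (Adj a b) (fm_leaf b) in
     fm_and (fm_branching a) (fm_and (fm_at_least \<psi> a (Suc n) 0) (Neg (fm_at_least \<psi> a (Suc (Suc n)) 0))))"

lemma sat_fm_label [simp]: "sat H (fm_label a n) v \<longleftrightarrow> label H (v a) n"
proof -
  have "sat H (fm_at_least (\<lambda>a b. fm_and (Adj a b) (fm_leaf b)) a m 0) v \<longleftrightarrow> at_least m {w. H (v a, w) \<and> leaf H w}" for m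
    by (subst sat_fm_at_least[where Q = "\<lambda>u w. H (u, w) \<and> leaf H w"]) simp_all
  then show ?thesis
    unfolding fm_label_def label_def Let_def card_eq_Suc_at_least
    by (simp del: fm_at_least.simps)
qed

lemma free_vars_fm_label: "free_vars (fm_label a n) \<subseteq> {a}"
proof -
  have "free_vars (fm_at_least (\<lambda>a b. fm_and (Adj a b) (fm_leaf b)) a m 0) \<subseteq> {a}" for m
    using free_vars_fm_at_least[of "\<lambda>a b. fm_and (Adj a b) (fm_leaf b)" a m 0] by auto
  then show ?thesis
    unfolding fm_label_def Let_def free_vars_connectives free_vars.simps free_vars_fm_branching by blast
qed

definition fm_label_edge :: "nat \<times> nat \<Rightarrow> fm" where
  "fm_label_edge = (\<lambda>(i, j). Ex 0 (Ex 1 (fm_and (fm_label 0 i) (fm_and (fm_label 1 j) (Adj 0 1)))))"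

lemma sat_fm_label_edge: "sat H (fm_label_edge p) v \<longleftrightarrow> label_graph H p"
  by (cases p) (simp add: fm_label_edge_def label_graph_def)

lemma free_vars_fm_label_edge: "free_vars (fm_label_edge p) = {}"
  using free_vars_fm_label[of 0] free_vars_fm_label[of 1]
  by (cases p) (auto simp: fm_label_edge_def)

text \<open>The \<open>All 0\<close> before the counting conjunct closes it according to the bound
  \<open>free_vars_fm_at_least\<close>, which for \<open>a = 0\<close> and \<open>k = 0\<close> is
  \<open>{0}\<close>.\<close>

definition fm_labelled :: fm where
  "fm_labelled = fm_and (All 0 (Neg (Adj 0 0)))
    (fm_and (All 0 (All 1 (fm_imp (Adj 0 1) (Adj 1 0))))
    (fm_and (All 0 (Conj (\<lambda>n. fm_at_least (\<lambda>a b. fm_isolated b) 0 n 0)))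
    (fm_and (All 0 (All 1 (fm_imp (fm_and (Adj 0 1) (fm_leaf 0)) (fm_branching 1))))
    (fm_and (All 0 (fm_imp (fm_branching 0)
        (fm_and (Disj (fm_label 0)) (Ex 1 (fm_and (fm_branching 1) (Adj 0 1))))))
      (Conj (\<lambda>n. All 0 (All 1 (fm_imp (fm_and (fm_label 0 n) (fm_label 1 n)) (Eq 0 1)))))))))"

lemma sat_fm_labelled: "sat H fm_labelled v \<longleftrightarrow> labelled H"
proof -
  have "sat H (fm_at_least (\<lambda>a b. fm_isolated b) 0 n 0) u \<longleftrightarrow> at_least n {w. isolated H w}" for n u
    by (subst sat_fm_at_least[where Q = "\<lambda>u w. isolated H w"]) simp_all
  then show ?thesis
    unfolding fm_labelled_def labelled_def graphs_def infinite_at_least by simp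
qed

lemma free_vars_fm_labelled: "free_vars fm_labelled = {}"
proof -
  have "free_vars (fm_at_least (\<lambda>a b. fm_isolated b) 0 n 0) \<subseteq> {0}" for n
    using free_vars_fm_at_least[of "\<lambda>a b. fm_isolated b" 0 n 0] by auto
  moreover have "x \<in> free_vars (fm_label a n) \<Longrightarrow> x = a" for x a n using free_vars_fm_label by blast
  ultimately show ?thesis
    unfolding fm_labelled_def by (auto; blast)
qed

text \<open>Induction over Borel sets: coordinates are edges between labels, complements become
  \<open>Neg\<close> and countable unions \<open>Disj\<close>.\<close>

lemma borel_definable:
  assumes "A \<in> sets borel"
  shows "\<exists>\<psi>. is_sentence \<psi> \<and> (\<forall>H v. sat H \<psi> v \<longleftrightarrow> label_graph H \<in> A)"
proof -
  let ?S = "{A. \<exists>\<psi>. is_sentence \<psi> \<and> (\<forall>H v. sat H \<psi> v \<longleftrightarrow> label_graph H \<in> A)}"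
  have "A \<in> ?S"
  proof (rule borel_cylinder_induct[OF _ _ assms])
    show "sigma_algebra UNIV ?S"
      unfolding sigma_algebra_iff2
    proof (intro conjI ballI allI impI)
      show "{} \<in> ?S"
        by (auto simp: is_sentence_def intro!: exI[of _ "Neg fm_true"])
      fix X assume "X \<in> ?S"
      then obtain \<psi> where "is_sentence \<psi>" "\<forall>H v. sat H \<psi> v \<longleftrightarrow> label_graph H \<in> X" by blast
      then show "UNIV - X \<in> ?S" by (auto simp: is_sentence_def intro!: exI[of _ "Neg \<psi>"])
    next
      fix X :: "nat \<Rightarrow> _" assume "range X \<subseteq> ?S"
      then have "\<forall>n. \<exists>\<psi>. is_sentence \<psi> \<and> (\<forall>H v. sat H \<psi> v \<longleftrightarrow> label_graph H \<in> X n)" by blast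
      then obtain \<psi> where "\<And>n. is_sentence (\<psi> n)" "\<And>n H v. sat H (\<psi> n) v \<longleftrightarrow> label_graph H \<in> X n" by metis
      then show "(\<Union>n. X n) \<in> ?S" by (auto simp: is_sentence_def intro!: exI[of _ "Disj \<psi>"])
    qed auto
    show "{g. g p} \<in> ?S" for p
      by (auto simp: is_sentence_def sat_fm_label_edge free_vars_fm_label_edge intro!: exI[of _ "fm_label_edge p"])
  qed
  then show ?thesis by simp
qed

lemma labelled_definable:
  assumes "A \<in> sets borel"
  obtains \<phi> where "is_sentence \<phi>" "\<forall>H v. sat H \<phi> v \<longleftrightarrow> labelled H \<and> label_graph H \<in> A"
proof -
  obtain \<psi> where "is_sentence \<psi>" "\<forall>H v. sat H \<psi> v \<longleftrightarrow> label_graph H \<in> A"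
    using borel_definable[OF assms] by blast
  then show ?thesis
    by (intro that[of "fm_and fm_labelled \<psi>"]) (auto simp: is_sentence_def sat_fm_labelled free_vars_fm_labelled)
qed

lemma borel_sat: "{H. sat H p v} \<in> sets borel"
proof (induction p arbitrary: v)
  case (Adj i j)
  have "Measurable.pred borel (\<lambda>H :: nat \<times> nat \<Rightarrow> bool. H (v i, v j))" by (rule measurable_fun_discreteD)
  then show ?case by (simp add: pred_def)
next
  case (Neg p)
  have "{H. sat H (Neg p) v} = - {H. sat H p v}" by auto
  then show ?case using Neg by simp
next
  case (Conj f)
  have "{H. sat H (Conj f) v} = (\<Inter>k. {H. sat H (f k) v})" by auto
  then show ?case using Conj by auto
next
  case (Disj f)
  have "{H. sat H (Disj f) v} = (\<Union>k. {H. sat H (f k) v})" by auto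
  then show ?case using Disj by auto
next
  case (All i p)
  have "{H. sat H (All i p) v} = (\<Inter>x. {H. sat H p (v(i := x))})" by auto
  then show ?case using All by auto
next
  case (Ex i p)
  have "{H. sat H (Ex i p) v} = (\<Union>x. {H. sat H p (v(i := x))})" by auto
  then show ?case using Ex by auto
qed simp

lemma sat_iso:
  assumes "bij \<pi>" and H: "\<And>n m. H (n, m) \<longleftrightarrow> H' (\<pi> n, \<pi> m)"
  shows "sat H p v \<longleftrightarrow> sat H' p (\<pi> \<circ> v)"
proof (induction p arbitrary: v)
  case (Eq i j)
  then show ?case using assms(1) by (simp add: bij_is_inj inj_eq)
next
  case (All i p)
  have "(\<forall>x. R (\<pi> x)) \<longleftrightarrow> (\<forall>y. R y)" for R :: "nat \<Rightarrow> bool"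
    using bij_is_surj[OF assms(1)] surj_f_inv_f by metis
  from this[of "\<lambda>y. sat H' p ((\<pi> \<circ> v)(i := y))"] show ?case
    unfolding sat.simps All fun_upd_comp .
next
  case (Ex i p)
  have "(\<exists>x. R (\<pi> x)) \<longleftrightarrow> (\<exists>y. R y)" for R :: "nat \<Rightarrow> bool"
    using bij_is_surj[OF assms(1)] surj_f_inv_f by metis
  from this[of "\<lambda>y. sat H' p ((\<pi> \<circ> v)(i := y))"] show ?case
    unfolding sat.simps Ex fun_upd_comp .
qed (simp_all add: H)

lemma label_graph_measurable: "label_graph \<in> measurable borel borel"
proof (rule measurable_fun_discreteI)
  show "Measurable.pred borel (\<lambda>H. label_graph H p)" for p
    using borel_sat[of "fm_label_edge p"] by (simp add: pred_def sat_fm_label_edge)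
qed

section \<open>Homomorphisms and epimorphisms of labelled graphs\<close>

definition graph_hom :: "(nat \<times> nat \<Rightarrow> bool) \<Rightarrow> (nat \<times> nat \<Rightarrow> bool) \<Rightarrow> bool" where
  "graph_hom H H' \<longleftrightarrow> (\<exists>f. \<forall>u v. H (u, v) \<longrightarrow> H' (f u, f v))"

lemma graph_hom_trans: "graph_hom H H' \<Longrightarrow> graph_hom H' H'' \<Longrightarrow> graph_hom H H''"
proof -
  assume "graph_hom H H'" "graph_hom H' H''"
  then obtain f g where "\<And>u v. H (u, v) \<Longrightarrow> H' (f u, f v)" "\<And>u v. H' (u, v) \<Longrightarrow> H'' (g u, g v)"
    unfolding graph_hom_def by blast
  then show "graph_hom H H''" unfolding graph_hom_def by (intro exI[of _ "g \<circ> f"]) simp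
qed

lemma graphsD:
  assumes "H \<in> graphs"
  shows "\<not> H (n, n)" "H (n, m) \<Longrightarrow> H (m, n)"
  using assms unfolding graphs_def by auto

lemma nonisolated_cases: "H (v, w) \<Longrightarrow> leaf H v \<or> branching H v"
  unfolding leaf_def branching_def by metis

lemma leaf_not_branching: "leaf H v \<Longrightarrow> \<not> branching H v"
  unfolding leaf_def branching_def by metis

lemma leaf_nbr_unique: "leaf H v \<Longrightarrow> H (v, w) \<Longrightarrow> H (v, w') \<Longrightarrow> w = w'"
  unfolding leaf_def by metis

lemma labelledD:
  assumes "labelled H"
  shows "H \<in> graphs" "infinite {v. isolated H v}" "H (v, w) \<Longrightarrow> leaf H v \<Longrightarrow> branching H w"
    "branching H v \<Longrightarrow> \<exists>n. label H v n" "branching H v \<Longrightarrow> \<exists>w. branching H w \<and> H (v, w)"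
    "label H v n \<Longrightarrow> label H w n \<Longrightarrow> v = w"
  using assms by (simp_all add: labelled_def)

lemma label_graph_hom:
  assumes H: "labelled H"
  shows "graph_hom (label_graph H) H"
  unfolding graph_hom_def
proof (intro exI allI impI)
  fix i j assume "label_graph H (i, j)"
  then obtain v w where vw: "label H v i" "label H w j" "H (v, w)" unfolding label_graph_def by auto
  have "(SOME v. label H v n) = u" if "label H u n" for u n
    using that labelledD(6)[OF H] by (intro some_equality)
  then show "H (SOME v. label H v i, SOME v. label H v j)" using vw by simp
qed

text \<open>A leaf is folded onto a branching vertex at distance two.\<close>

lemma hom_label_graph:
  assumes H: "labelled H"
  shows "graph_hom H (label_graph H)"
proof -
  note G = labelledD(1)[OF H] and leaf = labelledD(3)[OF H] and lab = labelledD(4)[OF H] and nbr = labelledD(5)[OF H]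
  define l where "l v = (SOME n. label H v n)" for v
  have l: "label H v (l v)" if "branching H v" for v
    unfolding l_def using lab[OF that] by (rule someI_ex)
  \<comment> \<open>For isolated \<open>v\<close> the choice is arbitrary, as no edge sees
    it.\<close>
  define g where "g v = (if branching H v then v else SOME u. branching H u \<and> (\<exists>w. H (v, w) \<and> H (w, u)))" for v
  have fold: "branching H (g v) \<and> H (g v, w)" if v: "leaf H v" and vw: "H (v, w)" for v w
  proof -
    obtain u where u: "branching H u" "H (w, u)" using nbr[OF leaf[OF vw v]] by blast
    have "branching H (g v) \<and> (\<exists>w. H (v, w) \<and> H (w, g v))"
      unfolding g_def using leaf_not_branching[OF v] u vw
      by (simp, intro someI[of "\<lambda>u. branching H u \<and> (\<exists>w. H (v, w) \<and> H (w, u))" u]) blast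
    then show ?thesis using leaf_nbr_unique[OF v vw] graphsD[OF G] by blast
  qed
  have edge: "branching H (g v) \<and> branching H (g w) \<and> H (g v, g w)" if vw: "H (v, w)" for v w
  proof (cases "leaf H v")
    case True
    then have "branching H w" using leaf vw by blast
    then show ?thesis using fold[OF True vw] by (simp add: g_def)
  next
    case v: False
    then have bv: "branching H v" using nonisolated_cases[of H v w, OF vw] by blast
    have wv: "H (w, v)" using graphsD(2)[OF G vw] .
    show ?thesis
    proof (cases "leaf H w")
      case True
      then show ?thesis using fold[OF True wv] bv graphsD(2)[OF G, of "g w" v] by (simp add: g_def)
    next
      case False
      then have "branching H w" using nonisolated_cases[of H w v, OF wv] by blast
      then show ?thesis using bv vw by (simp add: g_def)
    qed
  qed
  show ?thesis
    unfolding graph_hom_def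
  proof (intro exI allI impI)
    fix v w assume "H (v, w)"
    then show "label_graph H (l (g v), l (g w))"
      unfolding label_graph_def using edge l by blast
  qed
qed

lemma epi_le_iff_hom:
  assumes "H \<in> graphs" "H' \<in> graphs" and inf: "infinite {v. isolated H' v}"
  shows "(H, H') \<in> epi_le \<longleftrightarrow> graph_hom H' H"
proof
  assume "(H, H') \<in> epi_le"
  then show "graph_hom H' H" unfolding epi_le_def graph_hom_def by blast
next
  assume "graph_hom H' H"
  then obtain f where f: "\<And>u v. H' (u, v) \<Longrightarrow> H (f u, f v)" unfolding graph_hom_def by blast
  let ?I = "{v. isolated H' v}"
  \<comment> \<open>Isolated vertices meet no edge, so there the homomorphism may be replaced by a
    bijection onto \<open>nat\<close>.\<close>
  define \<gamma> where "\<gamma> v = (if isolated H' v then to_nat_on ?I v else f v)" for v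
  have "bij_betw (to_nat_on ?I) ?I UNIV" using inf by (intro to_nat_on_infinite) simp
  then have "UNIV \<subseteq> \<gamma> ` ?I" unfolding \<gamma>_def bij_betw_def by simp
  then have "surj \<gamma>" by blast
  moreover have "H (\<gamma> n, \<gamma> m)" if nm: "H' (n, m)" for n m
  proof -
    have "\<not> isolated H' n" "\<not> isolated H' m"
      using nm graphsD(2)[OF assms(2) nm] unfolding isolated_def by blast+
    then show ?thesis using f[OF nm] by (simp add: \<gamma>_def)
  qed
  ultimately show "(H, H') \<in> epi_le" using assms unfolding epi_le_def by blast
qed

text \<open>A labelled graph and its label graph are homomorphically equivalent. The order is
  reversed because epimorphisms run from the second graph to the first.\<close>

lemma epi_le_labelled:
  assumes "labelled H" "labelled H'"
  shows "(H, H') \<in> epi_le \<longleftrightarrow> graph_hom (label_graph H') (label_graph H)"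
proof -
  have "(H, H') \<in> epi_le \<longleftrightarrow> graph_hom H' H"
    by (rule epi_le_iff_hom) (use assms in \<open>simp_all add: labelled_def\<close>)
  also have "\<dots> \<longleftrightarrow> graph_hom (label_graph H') (label_graph H)"
  proof
    assume "graph_hom H' H"
    then show "graph_hom (label_graph H') (label_graph H)"
      by (rule graph_hom_trans[OF label_graph_hom[OF assms(2)] graph_hom_trans[OF _ hom_label_graph[OF assms(1)]]])
  next
    assume "graph_hom (label_graph H') (label_graph H)"
    then show "graph_hom H' H"
      by (rule graph_hom_trans[OF hom_label_graph[OF assms(2)] graph_hom_trans[OF _ label_graph_hom[OF assms(1)]]])
  qed
  finally show ?thesis .
qed

text \<open>\<open>(j, 0)\<close> stands for the vertex \<open>j\<close> of \<open>\<Gamma>\<close>, \<open>(j, k)\<close> with \<open>1 \<le> k \<le> j + 1\<close> for its leaves; the other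
  pairs are isolated.\<close>

fun leafed_adj :: "(nat \<times> nat \<Rightarrow> bool) \<Rightarrow> nat \<times> nat \<Rightarrow> nat \<times> nat \<Rightarrow> bool" where
  "leafed_adj \<Gamma> (i, k) (j, l) \<longleftrightarrow> (k = 0 \<and> l = 0 \<and> \<Gamma> (i, j)) \<or>
     (i = j \<and> (k = 0 \<and> l \<in> {1..Suc i} \<or> l = 0 \<and> k \<in> {1..Suc i}) \<and> (\<exists>m. \<Gamma> (i, m)))"

definition realize :: "(nat \<times> nat \<Rightarrow> bool) \<Rightarrow> nat \<times> nat \<Rightarrow> bool" where
  "realize \<Gamma> = (\<lambda>(u, v). leafed_adj \<Gamma> (prod_decode u) (prod_decode v))"

lemma realize_encode: "realize \<Gamma> (prod_encode p, prod_encode q) = leafed_adj \<Gamma> p q"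
  by (simp add: realize_def)

lemma ex_encode: "(\<exists>v. Q v) \<longleftrightarrow> (\<exists>p. Q (prod_encode p))"
  by (metis prod_decode_inverse)

lemma all_encode: "(\<forall>v. Q v) \<longleftrightarrow> (\<forall>p. Q (prod_encode p))"
  by (metis prod_decode_inverse)

text \<open>A vertex with a neighbour in \<open>\<Gamma>\<close> also has the leaf
  \<open>(j, 1)\<close>, so it branches even if its degree in \<open>\<Gamma>\<close> is
  one.\<close>

lemma realize_branching:
  assumes "\<Gamma> \<in> graphs"
  shows "branching (realize \<Gamma>) (prod_encode (j, k)) \<longleftrightarrow> k = 0 \<and> (\<exists>m. \<Gamma> (j, m))"
proof
  assume "branching (realize \<Gamma>) (prod_encode (j, k))"
  then obtain a b a' b' where "(a, b) \<noteq> (a', b')" "leafed_adj \<Gamma> (j, k) (a, b)" "leafed_adj \<Gamma> (j, k) (a', b')"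
    unfolding branching_def ex_encode realize_encode by (metis surj_pair)
  then show "k = 0 \<and> (\<exists>m. \<Gamma> (j, m))" by auto
next
  assume "k = 0 \<and> (\<exists>m. \<Gamma> (j, m))"
  then obtain m where "k = 0" "\<Gamma> (j, m)" by blast
  then have "leafed_adj \<Gamma> (j, k) (m, 0)" "leafed_adj \<Gamma> (j, k) (j, 1)" "(m, 0) \<noteq> (j, 1::nat)" by auto
  then show "branching (realize \<Gamma>) (prod_encode (j, k))"
    unfolding branching_def ex_encode realize_encode prod_encode_eq by blast
qed

lemma realize_leaf:
  assumes "\<Gamma> \<in> graphs"
  shows "leaf (realize \<Gamma>) (prod_encode (j, k)) \<longleftrightarrow> k \<in> {1..Suc j} \<and> (\<exists>m. \<Gamma> (j, m))"
proof
  assume L: "leaf (realize \<Gamma>) (prod_encode (j, k))"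
  then have "\<not> (k = 0 \<and> (\<exists>m. \<Gamma> (j, m)))"
    using leaf_not_branching realize_branching[OF assms] by blast
  moreover obtain a b where "leafed_adj \<Gamma> (j, k) (a, b)"
    using L unfolding leaf_def ex_encode realize_encode by (metis surj_pair)
  ultimately show "k \<in> {1..Suc j} \<and> (\<exists>m. \<Gamma> (j, m))" by auto
next
  assume *: "k \<in> {1..Suc j} \<and> (\<exists>m. \<Gamma> (j, m))"
  then have "leafed_adj \<Gamma> (j, k) (j, 0)" by simp
  moreover have "leafed_adj \<Gamma> (j, k) q \<Longrightarrow> q = (j, 0)" for q using * by (cases q) auto
  ultimately show "leaf (realize \<Gamma>) (prod_encode (j, k))"
    unfolding leaf_def ex_encode all_encode realize_encode prod_encode_eq by blast
qed

text \<open>The neighbours of \<open>(j, 0)\<close> coming from \<open>\<Gamma>\<close> branch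
  themselves, so only the \<open>j + 1\<close> attached leaves are counted.\<close>

lemma realize_label:
  assumes "\<Gamma> \<in> graphs"
  shows "label (realize \<Gamma>) (prod_encode (j, k)) n \<longleftrightarrow> j = n \<and> k = 0 \<and> (\<exists>m. \<Gamma> (j, m))"
proof (cases "k = 0 \<and> (\<exists>m. \<Gamma> (j, m))")
  case True
  have "{w. realize \<Gamma> (prod_encode (j, k), w) \<and> leaf (realize \<Gamma>) w} = prod_encode ` ({j} \<times> {1..Suc j})"
  proof (rule set_eqI)
    fix w
    obtain a b where w: "w = prod_encode (a, b)" by (metis prod_decode_inverse surj_pair)
    show "w \<in> {w. realize \<Gamma> (prod_encode (j, k), w) \<and> leaf (realize \<Gamma>) w} \<longleftrightarrow> w \<in> prod_encode ` ({j} \<times> {1..Suc j})"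
      using True unfolding w by (auto simp: realize_encode realize_leaf[OF assms] inj_image_mem_iff[OF inj_prod_encode])
  qed
  then have "card {w. realize \<Gamma> (prod_encode (j, k), w) \<and> leaf (realize \<Gamma>) w} = Suc j"
    by (simp add: card_image[OF inj_prod_encode] card_cartesian_product)
  then show ?thesis using True unfolding label_def realize_branching[OF assms] by auto
next
  case False
  then show ?thesis unfolding label_def realize_branching[OF assms] by auto
qed

lemma label_graph_realize:
  assumes "\<Gamma> \<in> graphs"
  shows "label_graph (realize \<Gamma>) = \<Gamma>"
proof (rule ext, clarify)
  fix i j
  have "label_graph (realize \<Gamma>) (i, j) \<longleftrightarrow>
      (\<exists>p q. label (realize \<Gamma>) (prod_encode p) i \<and> label (realize \<Gamma>) (prod_encode q) j \<and> leafed_adj \<Gamma> p q)"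
    unfolding label_graph_def prod.case ex_encode realize_encode ..
  also have "\<dots> \<longleftrightarrow> \<Gamma> (i, j)"
    using graphsD(2)[OF assms] by (auto simp: realize_label[OF assms])
  finally show "label_graph (realize \<Gamma>) (i, j) = \<Gamma> (i, j)" .
qed

lemma labelled_realize:
  assumes G: "\<Gamma> \<in> graphs"
  shows "labelled (realize \<Gamma>)"
  unfolding labelled_def
proof (intro conjI)
  show "realize \<Gamma> \<in> graphs"
    unfolding graphs_def mem_Collect_eq all_encode realize_encode
    using graphsD[OF G] by (auto simp: split_paired_all)
  \<comment> \<open>Vertex 0 has at most the leaf \<open>(0, 1)\<close>, so the pairs
    \<open>(0, k + 2)\<close> are isolated.\<close>
  have "(\<lambda>k. prod_encode (0, k + 2)) ` UNIV \<subseteq> {v. isolated (realize \<Gamma>) v}"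
    unfolding isolated_def all_encode by (auto simp: realize_encode)
  moreover have "infinite ((\<lambda>k. prod_encode (0, k + 2)) ` (UNIV :: nat set))"
    by (rule range_inj_infinite) (auto intro!: injI)
  ultimately show "infinite {v. isolated (realize \<Gamma>) v}" using infinite_super by blast
  show "\<forall>v w. realize \<Gamma> (v, w) \<and> leaf (realize \<Gamma>) v \<longrightarrow> branching (realize \<Gamma>) w"
    unfolding all_encode realize_encode by (auto simp: realize_leaf[OF G] realize_branching[OF G])
  show "\<forall>v. branching (realize \<Gamma>) v \<longrightarrow>
      (\<exists>n. label (realize \<Gamma>) v n) \<and> (\<exists>w. branching (realize \<Gamma>) w \<and> realize \<Gamma> (v, w))"
    unfolding all_encode
  proof (intro allI impI)
    fix p assume *: "branching (realize \<Gamma>) (prod_encode p)"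
    obtain i k where p: "p = (i, k)" by (cases p)
    from * have "branching (realize \<Gamma>) (prod_encode (i, k))" unfolding p .
    then obtain m where m: "k = 0" "\<Gamma> (i, m)" unfolding realize_branching[OF G] by blast
    then have "label (realize \<Gamma>) (prod_encode (i, k)) i" unfolding realize_label[OF G] by blast
    moreover have "branching (realize \<Gamma>) (prod_encode (m, 0))" "realize \<Gamma> (prod_encode (i, k), prod_encode (m, 0))"
      using m graphsD(2)[OF G] unfolding realize_branching[OF G] realize_encode by auto
    ultimately show "(\<exists>n. label (realize \<Gamma>) (prod_encode p) n) \<and>
        (\<exists>w. branching (realize \<Gamma>) w \<and> realize \<Gamma> (prod_encode p, w))" unfolding p by blast
  qed
  show "\<forall>n v w. label (realize \<Gamma>) v n \<and> label (realize \<Gamma>) w n \<longrightarrow> v = w"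
  proof (intro allI impI)
    fix n v w assume "label (realize \<Gamma>) v n \<and> label (realize \<Gamma>) w n"
    then show "v = w"
      by (metis prod_decode_inverse surj_pair realize_label[OF G])
  qed
qed

lemma realize_measurable: "realize \<in> measurable borel borel"
proof (rule measurable_fun_discreteI)
  fix p :: "nat \<times> nat"
  obtain i k j l where p: "p = (prod_encode (i, k), prod_encode (j, l))"
    by (metis prod_decode_inverse surj_pair)
  have "Measurable.pred borel (\<lambda>\<Gamma> :: nat \<times> nat \<Rightarrow> bool. \<Gamma> q)" for q by (rule measurable_fun_discreteD)
  then show "Measurable.pred borel (\<lambda>\<Gamma>. realize \<Gamma> p)"
    unfolding p realize_encode leafed_adj.simps
    by (intro pred_intros_logic pred_intros_countable measurable_const) simp_all
qed

section \<open>The space of graphs\<close>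

lemma closed_graphs: "closed graphs"
proof -
  have *: "closed {H :: nat \<times> nat \<Rightarrow> bool. Q (H p) (H q)}" for Q p q
  proof -
    have "continuous_on UNIV (\<lambda>H :: nat \<times> nat \<Rightarrow> bool. H p)" for p
      by (rule continuous_on_product_coordinates)
    then have cl: "closed ((\<lambda>H :: nat \<times> nat \<Rightarrow> bool. H p) -` X)" for p X
      by (intro closed_vimage) (simp_all add: closed_def open_discrete)
    have "{H :: nat \<times> nat \<Rightarrow> bool. Q (H p) (H q)} =
       (\<Union>a \<in> UNIV. (\<lambda>H. H p) -` {a} \<inter> (\<lambda>H. H q) -` {b. Q a b})" by auto
    also have "closed \<dots>" by (intro closed_UN ballI closed_Int cl finite)
    finally show ?thesis .
  qed
  have "graphs = (\<Inter>n. {H. \<not> H (n, n)}) \<inter> (\<Inter>n. \<Inter>m. {H. H (n, m) \<longrightarrow> H (m, n)})"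
    unfolding graphs_def by auto
  also have "closed \<dots>"
    using *[of "\<lambda>a b. \<not> a"] *[of "\<lambda>a b. a \<longrightarrow> b"] by (intro closed_Int closed_INT ballI)
  finally show ?thesis .
qed

lemma graphs_borel: "graphs \<in> sets borel"
  using closed_graphs by (rule borel_closed)

lemma space_graph_space: "space graph_space = graphs"
  by (simp add: graph_space_def borel_of_def graph_topology_def space_measure_of_conv)

lemma sets_graph_space: "sets graph_space = sets (restrict_space borel graphs)"
proof -
  have "sets graph_space = sigma_sets graphs {U. openin (subtopology euclidean graphs) U}"
    unfolding graph_space_def borel_of_def graph_topology_def
    by (simp add: sets_measure_of_conv) (auto simp: openin_subtopology)
  also have "{U. openin (subtopology euclidean graphs) U} = (\<inter>) graphs ` {U. open U}"
    by (auto simp: openin_subtopology)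
  also have "sigma_sets graphs \<dots> = (\<inter>) graphs ` sigma_sets UNIV {U. open U}"
    by (rule sigma_sets_Int[symmetric]) (use graphs_borel in \<open>simp_all add: borel_def sets_measure_of_conv\<close>)
  also have "\<dots> = sets (restrict_space borel graphs)"
    by (simp add: sets_restrict_space borel_def)
  finally show ?thesis .
qed

lemma measurable_graph_spaceI:
  assumes "f \<in> borel_measurable M" "\<And>x. x \<in> space M \<Longrightarrow> f x \<in> graphs"
  shows "f \<in> measurable M graph_space"
proof -
  have "f \<in> measurable M (restrict_space borel graphs)"
    using assms by (intro measurable_restrict_space2) auto
  then show ?thesis using measurable_cong_sets[OF refl sets_graph_space] by blast
qed

lemma measurable_graph_spaceD:
  assumes "f \<in> measurable borel N"
  shows "f \<in> measurable graph_space N"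
proof -
  have "f \<in> measurable (restrict_space borel graphs) N" using assms by (rule measurable_restrict_space1)
  then show ?thesis using measurable_cong_sets[OF sets_graph_space refl] by blast
qed

lemma standard_borel_graph_space: "standard_borel graph_space"
  unfolding standard_borel_def
proof (intro exI[of _ graph_topology] conjI)
  have "completely_metrizable_space (euclidean :: bool topology)"
  proof -
    have "(euclidean :: bool topology) = discrete_topology UNIV"
      by (simp add: topology_eq open_discrete)
    then show ?thesis using completely_metrizable_space_discrete_topology by metis
  qed
  then have "completely_metrizable_space (product_topology (\<lambda>_ :: nat \<times> nat. euclidean :: bool topology) UNIV)"
    unfolding completely_metrizable_space_product_topology by (auto intro: countableI_type)
  then have "completely_metrizable_space (euclidean :: (nat \<times> nat \<Rightarrow> bool) topology)"
    by (simp add: euclidean_product_topology)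
  then have 1: "completely_metrizable_space graph_topology"
    unfolding graph_topology_def using closed_graphs by (intro completely_metrizable_space_closedin) auto
  obtain \<B> :: "(nat \<times> nat \<Rightarrow> bool) set set" where B: "countable \<B>" "topological_basis \<B>"
    using ex_countable_basis by blast
  have "second_countable (euclidean :: (nat \<times> nat \<Rightarrow> bool) topology)"
    unfolding second_countable_def
    using B topological_basisE[OF B(2)] topological_basis_open[OF B(2)] by (intro exI[of _ \<B>]) (auto, metis)
  then have "separable_space graph_topology"
    unfolding graph_topology_def by (intro second_countable_imp_separable_space second_countable_subtopology)
  with 1 show "polish_space graph_topology" unfolding polish_space_def ..
  show "space graph_space = topspace graph_topology" by (simp add: space_graph_space graph_topology_def)
qed (simp add: graph_space_def)

text \<open>The atomic conditions on two graphs and a map, from which epimorphisms and isomorphisms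
  are described by countable quantifiers.\<close>

lemma graph_coordinates:
  defines "M \<equiv> (graph_space \<Otimes>\<^sub>M graph_space) \<Otimes>\<^sub>M (borel :: (nat \<Rightarrow> nat) measure)"
  shows "Measurable.pred M (\<lambda>w. fst (fst w) p)"
    "Measurable.pred M (\<lambda>w. snd (fst w) p)"
    "Measurable.pred M (\<lambda>w. fst (fst w) (snd w m, snd w n))"
    "Measurable.pred M (\<lambda>w. snd (fst w) (snd w m, snd w n))"
    "Measurable.pred M (\<lambda>w. snd w m = n)"
    "Measurable.pred M (\<lambda>w. snd w m = snd w n)"
proof -
  have c: "Measurable.pred graph_space (\<lambda>H. H p)" for p
    by (rule measurable_graph_spaceD) (rule measurable_fun_discreteD)
  have 1: "Measurable.pred M (\<lambda>w. fst (fst w) p)" for p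
    unfolding M_def by (rule measurable_compose[OF measurable_compose[OF measurable_fst measurable_fst] c])
  have 2: "Measurable.pred M (\<lambda>w. snd (fst w) p)" for p
    unfolding M_def by (rule measurable_compose[OF measurable_compose[OF measurable_fst measurable_snd] c])
  have 3: "(\<lambda>w. snd w m) \<in> measurable M (count_space UNIV)" for m
    unfolding M_def by (rule measurable_compose[OF measurable_snd measurable_fun_discreteD])
  have 4: "(\<lambda>w. (snd w m, snd w n)) \<in> measurable M (count_space UNIV)" for m n
    using measurable_Pair[OF 3[of m] 3[of n]] by (simp add: pair_measure_countable)
  show "Measurable.pred M (\<lambda>w. fst (fst w) p)" "Measurable.pred M (\<lambda>w. snd (fst w) p)" by (fact 1 2)+
  show "Measurable.pred M (\<lambda>w. fst (fst w) (snd w m, snd w n))"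
    by (rule measurable_compose_countable[OF 1 4])
  show "Measurable.pred M (\<lambda>w. snd (fst w) (snd w m, snd w n))"
    by (rule measurable_compose_countable[OF 2 4])
  show "Measurable.pred M (\<lambda>w. snd w m = n)"
    by (rule measurable_compose[OF 3]) simp
  show "Measurable.pred M (\<lambda>w. snd w m = snd w n)"
    using measurable_compose[OF 4[of m n], of "\<lambda>p. fst p = snd p"] by simp
qed

lemma analytic_inI:
  assumes "Measurable.pred ((graph_space \<Otimes>\<^sub>M graph_space) \<Otimes>\<^sub>M (borel :: (nat \<Rightarrow> nat) measure)) Q"
    and "\<And>H H'. (H, H') \<in> R \<longleftrightarrow> H \<in> graphs \<and> H' \<in> graphs \<and> (\<exists>\<gamma>. Q ((H, H'), \<gamma>))"
  shows "analytic_in (graph_space \<Otimes>\<^sub>M graph_space) R"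
  unfolding analytic_in_def
proof (rule bexI)
  let ?C = "{w \<in> space ((graph_space \<Otimes>\<^sub>M graph_space) \<Otimes>\<^sub>M (borel :: (nat \<Rightarrow> nat) measure)). Q w}"
  show "?C \<in> sets ((graph_space \<Otimes>\<^sub>M graph_space) \<Otimes>\<^sub>M (borel :: (nat \<Rightarrow> nat) measure))"
    using assms(1) by (simp only: pred_def)
  show "R = fst ` ?C"
    using assms(2) by (force simp: space_pair_measure space_graph_space image_iff)
qed

lemma analytic_epi_le: "analytic_in (graph_space \<Otimes>\<^sub>M graph_space) epi_le"
proof (rule analytic_inI[where Q = "\<lambda>w. (\<forall>m. \<exists>n. snd w n = m) \<and>
    (\<forall>n m. snd (fst w) (n, m) \<longrightarrow> fst (fst w) (snd w n, snd w m))"])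
  show "(H, H') \<in> epi_le \<longleftrightarrow> H \<in> graphs \<and> H' \<in> graphs \<and> (\<exists>\<gamma>. (\<forall>m. \<exists>n. snd ((H, H'), \<gamma>) n = m) \<and>
    (\<forall>n m. snd (fst ((H, H'), \<gamma>)) (n, m) \<longrightarrow> fst (fst ((H, H'), \<gamma>)) (snd ((H, H'), \<gamma>) n, snd ((H, H'), \<gamma>) m)))" for H H'
    unfolding epi_le_def surj_def by (simp add: eq_commute)
qed (intro pred_intros_logic pred_intros_countable graph_coordinates)

lemma analytic_graph_iso: "analytic_in (graph_space \<Otimes>\<^sub>M graph_space) graph_iso"
proof (rule analytic_inI[where Q = "\<lambda>w. ((\<forall>m n. snd w m = snd w n \<longrightarrow> m = n) \<and> (\<forall>m. \<exists>n. snd w n = m)) \<and>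
    (\<forall>n m. fst (fst w) (n, m) \<longleftrightarrow> snd (fst w) (snd w n, snd w m))"])
  show "(H, H') \<in> graph_iso \<longleftrightarrow> H \<in> graphs \<and> H' \<in> graphs \<and>
    (\<exists>\<gamma>. ((\<forall>m n. snd ((H, H'), \<gamma>) m = snd ((H, H'), \<gamma>) n \<longrightarrow> m = n) \<and> (\<forall>m. \<exists>n. snd ((H, H'), \<gamma>) n = m)) \<and>
    (\<forall>n m. fst (fst ((H, H'), \<gamma>)) (n, m) \<longleftrightarrow> snd (fst ((H, H'), \<gamma>)) (snd ((H, H'), \<gamma>) n, snd ((H, H'), \<gamma>) m)))" for H H'
    unfolding graph_iso_def bij_def inj_def surj_def by (simp add: eq_commute)
qed (intro pred_intros_logic pred_intros_countable graph_coordinates measurable_const, simp)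

lemma analytic_quasi_order_epi_le: "analytic_quasi_order graph_space epi_le"
  unfolding analytic_quasi_order_def preorder_on_def
proof (intro conjI analytic_epi_le)
  show "epi_le \<subseteq> space graph_space \<times> space graph_space"
    unfolding epi_le_def space_graph_space by auto
  show "refl_on (space graph_space) epi_le"
    unfolding refl_on_def epi_le_def space_graph_space by (auto intro!: exI[of _ id])
  show "trans epi_le"
  proof (rule transI)
    fix H H' H'' assume "(H, H') \<in> epi_le" "(H', H'') \<in> epi_le"
    then obtain f g where fg: "H \<in> graphs" "H'' \<in> graphs" "surj f" "surj g"
      "\<And>n m. H' (n, m) \<Longrightarrow> H (f n, f m)" "\<And>n m. H'' (n, m) \<Longrightarrow> H' (g n, g m)"
      unfolding epi_le_def by blast
    then show "(H, H'') \<in> epi_le"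
      unfolding epi_le_def by (auto intro!: exI[of _ "f \<circ> g"] comp_surj)
  qed
qed

lemma graph_iso_sym: "(H, H') \<in> graph_iso \<Longrightarrow> (H', H) \<in> graph_iso"
proof -
  assume "(H, H') \<in> graph_iso"
  then obtain \<pi> where \<pi>: "H \<in> graphs" "H' \<in> graphs" "bij \<pi>" "\<And>n m. H (n, m) \<longleftrightarrow> H' (\<pi> n, \<pi> m)"
    unfolding graph_iso_def by blast
  have "H' (n, m) \<longleftrightarrow> H (inv \<pi> n, inv \<pi> m)" for n m
    using \<pi>(3,4) by (simp add: bij_is_surj surj_f_inv_f)
  then show "(H', H) \<in> graph_iso"
    using \<pi> bij_imp_bij_inv[OF \<pi>(3)] unfolding graph_iso_def by auto
qed

lemma graph_iso_epi_le: "graph_iso \<subseteq> epi_le"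
proof (rule subrelI)
  fix H H' assume "(H, H') \<in> graph_iso"
  from graph_iso_sym[OF this] obtain \<pi> where "H \<in> graphs" "H' \<in> graphs" "bij \<pi>"
    "\<And>n m. H' (n, m) \<longleftrightarrow> H (\<pi> n, \<pi> m)"
    unfolding graph_iso_def by blast
  then show "(H, H') \<in> epi_le"
    unfolding epi_le_def using bij_is_surj[of \<pi>] by blast
qed

lemma analytic_equivalence_graph_iso: "analytic_equivalence graph_space graph_iso"
  unfolding analytic_equivalence_def
proof (intro conjI equivI analytic_graph_iso)
  show "graph_iso \<subseteq> space graph_space \<times> space graph_space"
    unfolding graph_iso_def space_graph_space by auto
  show "refl_on (space graph_space) graph_iso"
    unfolding refl_on_def graph_iso_def space_graph_space by (auto intro!: exI[of _ id])
  show "sym graph_iso" using graph_iso_sym by (rule symI)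
  show "trans graph_iso"
  proof (rule transI)
    fix H H' H'' assume "(H, H') \<in> graph_iso" "(H', H'') \<in> graph_iso"
    then obtain f g where fg: "H \<in> graphs" "H'' \<in> graphs" "bij f" "bij g"
      "\<And>n m. H (n, m) \<longleftrightarrow> H' (f n, f m)" "\<And>n m. H' (n, m) \<longleftrightarrow> H'' (g n, g m)"
      unfolding graph_iso_def by blast
    then show "(H, H'') \<in> graph_iso"
      unfolding graph_iso_def by (auto intro!: exI[of _ "g \<circ> f"] bij_comp)
  qed
qed

section \<open>Invariant universality\<close>

text \<open>\<open>from_nat\<close> is onto but may repeat values; repeated vertices do not affect
  the existence of homomorphisms.\<close>

definition tree_graph :: "((bool \<times> bool \<times> nat) list \<Rightarrow> bool) \<Rightarrow> (nat \<Rightarrow> bool) \<Rightarrow> nat \<times> nat \<Rightarrow> bool" where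
  "tree_graph P x = (\<lambda>(i, j). tree_adj P x (from_nat i) (from_nat j))"

lemma tree_graph_graphs: "tree_graph P x \<in> graphs"
  unfolding graphs_def tree_graph_def using tree_adj_irrefl tree_adj_sym by auto

lemma tree_graph_hom:
  "graph_hom (tree_graph P x) (tree_graph P y) \<longleftrightarrow> (\<exists>f. \<forall>u v. tree_adj P x u v \<longrightarrow> tree_adj P y (f u) (f v))"
proof
  assume "graph_hom (tree_graph P x) (tree_graph P y)"
  then obtain f where f: "\<And>i j. tree_adj P x (from_nat i) (from_nat j) \<Longrightarrow> tree_adj P y (from_nat (f i)) (from_nat (f j))"
    unfolding graph_hom_def tree_graph_def by auto
  have "tree_adj P y (from_nat (f (to_nat u))) (from_nat (f (to_nat v)))" if "tree_adj P x u v" for u v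
    using that by (intro f) simp
  then show "\<exists>f. \<forall>u v. tree_adj P x u v \<longrightarrow> tree_adj P y (f u) (f v)"
    by (intro exI[of _ "\<lambda>u. from_nat (f (to_nat u))"]) blast
next
  assume "\<exists>f. \<forall>u v. tree_adj P x u v \<longrightarrow> tree_adj P y (f u) (f v)"
  then obtain f where f: "\<And>u v. tree_adj P x u v \<Longrightarrow> tree_adj P y (f u) (f v)" by blast
  then show "graph_hom (tree_graph P x) (tree_graph P y)"
    unfolding graph_hom_def tree_graph_def by (intro exI[of _ "\<lambda>i. to_nat (f (from_nat i))"]) simp
qed

lemma pred_finite_dependence:
  assumes Q: "\<And>x y :: nat \<Rightarrow> bool. (\<And>i. i < n \<Longrightarrow> x i = y i) \<Longrightarrow> Q x \<longleftrightarrow> Q y"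
  shows "Measurable.pred borel Q"
proof -
  have c: "{x :: nat \<Rightarrow> bool. x i = b} \<in> sets borel" for i b
    using measurable_compose[OF measurable_fun_discreteD[of i], of "\<lambda>a. a = b" "count_space UNIV"]
    by (simp add: pred_def)
  \<comment> \<open>Lists name the possible initial segments, of which there are countably
    many.\<close>
  have "{x. Q x} = (\<Union>l \<in> {l. Q (\<lambda>i. l ! i)}. \<Inter>i \<in> {i. i < n}. {x. x i = l ! i})"
  proof (intro set_eqI iffI)
    fix x assume "x \<in> {x. Q x}"
    then have "Q (\<lambda>i. map x [0..<n] ! i)" using Q[of x "\<lambda>i. map x [0..<n] ! i"] by simp
    then show "x \<in> (\<Union>l \<in> {l. Q (\<lambda>i. l ! i)}. \<Inter>i \<in> {i. i < n}. {x. x i = l ! i})" by auto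
  next
    fix x assume "x \<in> (\<Union>l \<in> {l. Q (\<lambda>i. l ! i)}. \<Inter>i \<in> {i. i < n}. {x. x i = l ! i})"
    then obtain l where "Q (\<lambda>i. l ! i)" "\<And>i. i < n \<Longrightarrow> x i = l ! i" by auto
    then show "x \<in> {x. Q x}" using Q[of x "\<lambda>i. l ! i"] by simp
  qed
  also have "\<dots> \<in> sets borel"
    by (intro sets.countable_UN'' sets.countable_INT'' countableI_type c) simp_all
  finally show ?thesis by (simp add: pred_def)
qed

lemma node_cong:
  assumes "\<And>i. i < length s \<Longrightarrow> x i = y i"
  shows "node P x s \<longleftrightarrow> node P y s"
proof -
  have eq: "map (\<lambda>i. (chain_bit x s j i, chain_bit x s (Suc j) i, snd (s ! i ! j))) [0..<m] =
      map (\<lambda>i. (chain_bit y s j i, chain_bit y s (Suc j) i, snd (s ! i ! j))) [0..<m]" if "m \<le> length s" for m j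
    using that assms by (auto simp: chain_bit_def)
  show ?thesis unfolding node_def
    by (intro conj_cong all_cong1 imp_cong refl) (rule arg_cong[where f = P], rule eq)
qed

text \<open>The bound is \<open>Suc (length s)\<close> because the bit of the empty word is read at
  index 0.\<close>

lemma node_core_cong:
  assumes "\<And>i. i < Suc (length s) \<Longrightarrow> x i = y i"
  shows "node_core x s = node_core y s"
  using assms by (simp add: node_core_def node_bit_def chain_bit_def)

lemma tree_adj_measurable: "Measurable.pred borel (\<lambda>x. tree_adj P x u v)"
proof -
  define len where "len = (\<lambda>u :: nat + column list. case u of Inl i \<Rightarrow> 0 | Inr s \<Rightarrow> Suc (length s))"
  show ?thesis
  proof (rule pred_finite_dependence[where n = "len u + len v"])
    fix x y :: "nat \<Rightarrow> bool" assume *: "\<And>i. i < len u + len v \<Longrightarrow> x i = y i"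
    have "node P x s = node P y s \<and> node_core x s = node_core y s" if "Suc (length s) \<le> len u + len v" for s
      using that * by (intro conjI node_cong node_core_cong) auto
    then show "tree_adj P x u v \<longleftrightarrow> tree_adj P y u v"
      by (cases u; cases v) (auto simp: len_def)
  qed
qed

lemma tree_graph_measurable: "tree_graph P \<in> measurable borel borel"
  by (rule measurable_fun_discreteI) (auto simp: tree_graph_def split_beta intro: tree_adj_measurable)

text \<open>Bit \<open>n\<close> is tested on the branch of empty columns, which exists over every
  \<open>x\<close>: the core vertex used is the one that belongs to the pair of \<open>True\<close>
  but not to that of \<open>False\<close>.\<close>

definition read_point :: "(nat \<times> nat \<Rightarrow> bool) \<Rightarrow> nat \<Rightarrow> bool" where
  "read_point \<Gamma> n = \<Gamma> (to_nat (Inl (Suc (anchor (Suc n) True)) :: nat + column list),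
     to_nat (Inr (replicate (Suc n) []) :: nat + column list))"

lemma read_point_tree_graph: "read_point (tree_graph P x) = x"
proof
  fix n
  let ?s = "replicate (Suc n) [] :: column list"
  have node: "node P x ?s" by (auto simp: node_def)
  have bit: "node_bit x ?s = x n" by (simp add: node_bit_def chain_bit_def del: replicate_Suc)
  have "Suc (anchor (Suc n) True) \<in> colour (Suc n) b \<longleftrightarrow> b" for b
    by (cases b) (auto simp: colour_def anchor_def)
  moreover have "Suc (anchor (Suc n) True) \<noteq> 9"
    using colour_less[of "Suc (anchor (Suc n) True)" "Suc n" True] unfolding colour_def by auto
  ultimately have "Suc (anchor (Suc n) True) \<in> node_core x ?s \<longleftrightarrow> x n"
    unfolding node_core_def length_replicate bit by (cases n) simp_all
  then show "read_point (tree_graph P x) n = x n"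
    using node by (simp add: read_point_def tree_graph_def del: replicate_Suc)
qed

lemma read_point_measurable: "read_point \<in> measurable borel borel"
  by (rule measurable_fun_discreteI) (simp add: read_point_def measurable_fun_discreteD)

text \<open>\<open>read_point\<close> is a Borel left inverse, so the image consists of the fixed
  points of \<open>tree_graph P\<close> after \<open>read_point\<close> whose points lie in
  \<open>B\<close>.\<close>

lemma tree_graphs_borel:
  assumes "B \<in> sets borel"
  shows "tree_graph P ` B \<in> sets borel"
proof -
  have c: "Measurable.pred borel (\<lambda>\<Gamma> :: nat \<times> nat \<Rightarrow> bool. \<Gamma> p)" for p by (rule measurable_fun_discreteD)
  have "(\<lambda>\<Gamma>. tree_graph P (read_point \<Gamma>)) \<in> measurable borel borel"
    by (rule measurable_compose[OF read_point_measurable tree_graph_measurable])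
  then have "Measurable.pred borel (\<lambda>\<Gamma>. tree_graph P (read_point \<Gamma>) p)" for p
    by (rule measurable_compose) (rule c)
  then have "Measurable.pred borel (\<lambda>\<Gamma>. \<forall>p. \<Gamma> p \<longleftrightarrow> tree_graph P (read_point \<Gamma>) p)"
    by (intro pred_intros_logic pred_intros_countable c)
  then have "{\<Gamma>. \<forall>p. \<Gamma> p \<longleftrightarrow> tree_graph P (read_point \<Gamma>) p} \<in> sets borel"
    unfolding pred_def by (simp only: space_borel UNIV_I simp_thms)
  moreover have "read_point -` B \<in> sets borel"
    using measurable_sets[OF read_point_measurable assms] by simp
  ultimately have "read_point -` B \<inter> {\<Gamma>. \<forall>p. \<Gamma> p \<longleftrightarrow> tree_graph P (read_point \<Gamma>) p} \<in> sets borel" by (rule sets.Int[rotated])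
  also have "read_point -` B \<inter> {\<Gamma>. \<forall>p. \<Gamma> p \<longleftrightarrow> tree_graph P (read_point \<Gamma>) p} = tree_graph P ` B"
  proof (intro equalityI subsetI)
    fix \<Gamma> assume "\<Gamma> \<in> read_point -` B \<inter> {\<Gamma>. \<forall>p. \<Gamma> p \<longleftrightarrow> tree_graph P (read_point \<Gamma>) p}"
    then have "\<Gamma> = tree_graph P (read_point \<Gamma>)" "read_point \<Gamma> \<in> B" by blast+
    then show "\<Gamma> \<in> tree_graph P ` B" by (rule image_eqI)
  qed (auto simp: read_point_tree_graph)
  finally show ?thesis .
qed

text \<open>Passing to the converse makes up for the reversal of homomorphisms in
  \<open>epi_le\<close>.\<close>

lemma converse_transport:
  fixes Y :: "'b measure"
  assumes Y: "standard_borel Y" and R: "analytic_quasi_order Y R"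
  obtains e B p S where "e \<in> measurable Y (borel :: (nat \<Rightarrow> bool) measure)" "B \<in> sets borel" "e ` space Y \<subseteq> B"
    "p \<in> measurable (restrict_space borel B) Y" "p ` B \<subseteq> space Y" "\<forall>z \<in> B. e (p z) = z"
    "preorder_on B S" "analytic_in (borel \<Otimes>\<^sub>M borel) S"
    "\<forall>x \<in> space Y. \<forall>y \<in> space Y. (x, y) \<in> R \<longleftrightarrow> (e y, e x) \<in> S"
proof -
  obtain e :: "'b \<Rightarrow> nat \<Rightarrow> bool" where e: "e \<in> borel_measurable Y" "e ` space Y \<in> sets borel"
    "inj_on e (space Y)" "inv_into (space Y) e \<in> measurable (restrict_space borel (e ` space Y)) Y"
    by (rule standard_borel_code[OF Y])
  define B where "B = e ` space Y"
  define p where "p = inv_into (space Y) e"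
  have pB: "p z \<in> space Y" "e (p z) = z" if "z \<in> B" for z
    using that unfolding p_def B_def by (simp_all add: inv_into_into f_inv_into_f)
  have pe: "p (e x) = x" if "x \<in> space Y" for x
    using that e(3) unfolding p_def by simp
  define S where "S = {(u, v). u \<in> B \<and> v \<in> B \<and> (p v, p u) \<in> R}"
  have RY: "R \<subseteq> space Y \<times> space Y" "refl_on (space Y) R" "trans R"
    using R unfolding analytic_quasi_order_def preorder_on_def by auto
  have "preorder_on B S"
    unfolding preorder_on_def
  proof (intro conjI)
    show "refl_on B S" using RY(2) pB(1) unfolding S_def refl_on_def by auto
    show "trans S" using RY(3) unfolding S_def trans_def by blast
  qed (auto simp: S_def)
  moreover have "analytic_in (borel \<Otimes>\<^sub>M borel) S"
  proof (cases "space Y = {}")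
    case True
    then have "S = fst ` {}" by (simp add: S_def B_def)
    then show ?thesis unfolding analytic_in_def by blast
  next
    case False
    then obtain c where c: "c \<in> space Y" by blast
    \<comment> \<open>Extending \<open>p\<close> by a constant outside \<open>B\<close> gives a
      total Borel map, at the price of a point of \<open>Y\<close>; hence the case
      distinction.\<close>
    define q where "q z = (if z \<in> B then p z else c)" for z
    have q: "q \<in> measurable borel Y"
      using e(4) measurable_restrict_space_iff[of B borel c Y p] e(2) c
      unfolding q_def B_def p_def by simp
    obtain C where C: "C \<in> sets ((Y \<Otimes>\<^sub>M Y) \<Otimes>\<^sub>M (borel :: (nat \<Rightarrow> nat) measure))" "R = fst ` C"
      using R unfolding analytic_quasi_order_def analytic_in_def by blast
    let ?N = "(borel \<Otimes>\<^sub>M borel) \<Otimes>\<^sub>M (borel :: (nat \<Rightarrow> nat) measure)"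
    define F where "F w = ((q (snd (fst w)), q (fst (fst w))), snd w)"
      for w :: "((nat \<Rightarrow> bool) \<times> (nat \<Rightarrow> bool)) \<times> (nat \<Rightarrow> nat)"
    have F: "F \<in> measurable ?N ((Y \<Otimes>\<^sub>M Y) \<Otimes>\<^sub>M borel)"
      unfolding F_def
      by (intro measurable_Pair measurable_compose[OF _ q] measurable_compose[OF measurable_fst measurable_fst]
          measurable_compose[OF measurable_fst measurable_snd] measurable_snd)
    have "B \<in> sets borel" using e(2) by (simp add: B_def)
    then have "(B \<times> B) \<times> UNIV \<in> sets ?N" by (intro pair_measureI) auto
    then have "F -` C \<inter> space ?N \<inter> (B \<times> B) \<times> UNIV \<in> sets ?N"
      using measurable_sets[OF F C(1)] by (rule sets.Int[rotated])
    moreover have "S = fst ` (F -` C \<inter> space ?N \<inter> (B \<times> B) \<times> UNIV)"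
    proof (rule set_eqI, clarify)
      fix u v
      show "(u, v) \<in> S \<longleftrightarrow> (u, v) \<in> fst ` (F -` C \<inter> space ?N \<inter> (B \<times> B) \<times> UNIV)"
      proof
        assume "(u, v) \<in> S"
        then have uv: "u \<in> B" "v \<in> B" "(p v, p u) \<in> R" unfolding S_def by auto
        then obtain b where "((p v, p u), b) \<in> C" using C(2) by auto
        then have "((u, v), b) \<in> F -` C \<inter> space ?N \<inter> (B \<times> B) \<times> UNIV"
          using uv by (simp add: F_def q_def space_pair_measure)
        then show "(u, v) \<in> fst ` (F -` C \<inter> space ?N \<inter> (B \<times> B) \<times> UNIV)" by (rule rev_image_eqI) simp
      next
        assume "(u, v) \<in> fst ` (F -` C \<inter> space ?N \<inter> (B \<times> B) \<times> UNIV)"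
        then obtain b where b: "((q v, q u), b) \<in> C" "u \<in> B" "v \<in> B" by (auto simp: F_def)
        have "(q v, q u) \<in> R" unfolding C(2) using b(1) by (rule rev_image_eqI) simp
        then show "(u, v) \<in> S" using b by (simp add: S_def q_def)
      qed
    qed
    ultimately show ?thesis unfolding analytic_in_def by blast
  qed
  moreover have "(x, y) \<in> R \<longleftrightarrow> (e y, e x) \<in> S" if "x \<in> space Y" "y \<in> space Y" for x y
    using that by (simp add: S_def B_def pe)
  ultimately show ?thesis
    using e pB by (intro that[of e B p S]) (auto simp: B_def p_def)
qed

text \<open>\<open>\<phi>\<close> axiomatises the labelled graphs whose label graph is some
  \<open>tree_graph P x\<close> with \<open>x\<close> in \<open>B\<close>. One reduction realizes
  the tree graph of the code of a point; the other reads \<open>x\<close> off the label graph and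
  decodes it.\<close>

lemma bireducible_Mod:
  fixes Y :: "'b measure"
  assumes "standard_borel Y" "analytic_quasi_order Y R"
  obtains \<phi> where "is_sentence \<phi>" "Mod \<phi> \<subseteq> graphs" "Mod \<phi> \<in> sets graph_space" "graph_iso `` Mod \<phi> \<subseteq> Mod \<phi>"
    "borel_bireducible Y R (restrict_space graph_space (Mod \<phi>)) (epi_le \<inter> Mod \<phi> \<times> Mod \<phi>)"
proof -
  obtain e B p S where e: "e \<in> measurable Y (borel :: (nat \<Rightarrow> bool) measure)" "B \<in> sets borel" "e ` space Y \<subseteq> B"
    and p: "p \<in> measurable (restrict_space borel B) Y" "p ` B \<subseteq> space Y" "\<forall>z \<in> B. e (p z) = z"
    and S: "preorder_on B S" "analytic_in (borel \<Otimes>\<^sub>M borel) S"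
    and R: "\<forall>x \<in> space Y. \<forall>y \<in> space Y. (x, y) \<in> R \<longleftrightarrow> (e y, e x) \<in> S"
    by (rule converse_transport[OF assms])
  obtain P :: "(bool \<times> bool \<times> nat) list \<Rightarrow> bool" where "\<forall>x y. (x, y) \<in> S \<longleftrightarrow> (\<exists>\<alpha>. \<forall>n. P (map (\<lambda>i. (x i, y i, \<alpha> i)) [0..<n]))"
    using analytic_normal_form[OF S(2)] ..
  then have P: "(x, y) \<in> S \<longleftrightarrow> (\<exists>\<alpha>. \<forall>n. P (map (\<lambda>i. (x i, y i, \<alpha> i)) [0..<n]))" for x y by simp
  let ?A = "tree_graph P ` B"
  obtain \<phi> where \<phi>: "is_sentence \<phi>" "\<forall>H v. sat H \<phi> v \<longleftrightarrow> labelled H \<and> label_graph H \<in> ?A"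
    by (rule labelled_definable[OF tree_graphs_borel[OF e(2)]])
  have Mod: "H \<in> Mod \<phi> \<longleftrightarrow> labelled H \<and> label_graph H \<in> ?A" for H
    by (simp add: Mod_def \<phi>(2))
  have sub: "Mod \<phi> \<subseteq> graphs" using Mod labelledD(1) by blast
  have "Mod \<phi> = {H. sat H \<phi> (\<lambda>_. 0)}" using Mod \<phi>(2) by blast
  then have borel: "Mod \<phi> \<in> sets borel" using borel_sat by simp
  then have "graphs \<inter> Mod \<phi> \<in> sets graph_space" unfolding sets_graph_space by (simp add: sets_restrict_space)
  then have meas: "Mod \<phi> \<in> sets graph_space" using sub by (simp add: Int_absorb1)
  have iso: "graph_iso `` Mod \<phi> \<subseteq> Mod \<phi>"
  proof
    fix H' assume "H' \<in> graph_iso `` Mod \<phi>"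
    then obtain H \<pi> where "H \<in> Mod \<phi>" "bij \<pi>" "\<And>n m. H (n, m) \<longleftrightarrow> H' (\<pi> n, \<pi> m)"
      unfolding graph_iso_def by blast
    then have "sat H' \<phi> (\<pi> \<circ> (\<lambda>_. 0))" using sat_iso[of \<pi> H H' \<phi>] unfolding Mod_def by blast
    then show "H' \<in> Mod \<phi>" using Mod \<phi>(2) by blast
  qed
  let ?M = "restrict_space graph_space (Mod \<phi>)"
  have space: "space ?M = Mod \<phi>" using sub by (simp add: space_restrict_space space_graph_space Int_absorb2)
  \<comment> \<open>Epimorphisms between models become homomorphisms of label graphs in the opposite
    direction, hence of trees, hence pairs in \<open>S\<close>.\<close>
  have epi: "(H, H') \<in> epi_le \<inter> Mod \<phi> \<times> Mod \<phi> \<longleftrightarrow> (y, x) \<in> S"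
    if "H \<in> Mod \<phi>" "H' \<in> Mod \<phi>" "label_graph H = tree_graph P x" "label_graph H' = tree_graph P y" "x \<in> B" "y \<in> B" for H H' x y
    using that epi_le_labelled[of H H'] Mod tree_graph_hom[of P y x] tree_hom_iff[of S P B y x, OF P S(1)] by simp
  have "borel_reducible Y R ?M (epi_le \<inter> Mod \<phi> \<times> Mod \<phi>)"
    unfolding borel_reducible_def
  proof (intro bexI ballI)
    let ?h = "\<lambda>x. realize (tree_graph P (e x))"
    have lab: "label_graph (?h x) = tree_graph P (e x)" for x
      by (rule label_graph_realize[OF tree_graph_graphs])
    have h: "?h x \<in> Mod \<phi>" if "x \<in> space Y" for x
      unfolding Mod lab using that e(3) labelled_realize[OF tree_graph_graphs] by blast
    show "(x, y) \<in> R \<longleftrightarrow> (?h x, ?h y) \<in> epi_le \<inter> Mod \<phi> \<times> Mod \<phi>" if "x \<in> space Y" "y \<in> space Y" for x y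
      using epi[OF h h lab lab] R that e(3) by (simp add: image_subset_iff)
    have "?h \<in> measurable Y graph_space"
      by (rule measurable_graph_spaceI)
        (rule measurable_compose[OF measurable_compose[OF e(1) tree_graph_measurable] realize_measurable],
          use h sub in blast)
    then show "?h \<in> measurable Y ?M" using h by (intro measurable_restrict_space2) auto
  qed
  moreover have "borel_reducible ?M (epi_le \<inter> Mod \<phi> \<times> Mod \<phi>) Y R"
    unfolding borel_reducible_def
  proof (intro bexI ballI)
    let ?r = "\<lambda>H. read_point (label_graph H)"
    have r: "?r H \<in> B" "label_graph H = tree_graph P (?r H)" if "H \<in> Mod \<phi>" for H
      using that unfolding Mod by (auto simp: read_point_tree_graph)
    show "(H, H') \<in> epi_le \<inter> Mod \<phi> \<times> Mod \<phi> \<longleftrightarrow> (p (?r H), p (?r H')) \<in> R"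
      if "H \<in> space ?M" "H' \<in> space ?M" for H H'
    proof -
      have HH: "H \<in> Mod \<phi>" "H' \<in> Mod \<phi>" using that unfolding space .
      have "p (?r H) \<in> space Y" "p (?r H') \<in> space Y" using p(2) r(1)[OF HH(1)] r(1)[OF HH(2)] by blast+
      then have "(p (?r H), p (?r H')) \<in> R \<longleftrightarrow> (?r H', ?r H) \<in> S"
        using R p(3) r(1) HH by simp
      then show ?thesis using epi[OF HH r(2)[OF HH(1)] r(2)[OF HH(2)] r(1)[OF HH(1)] r(1)[OF HH(2)]] by simp
    qed
    have "?r \<in> measurable ?M borel"
      by (intro measurable_restrict_space1 measurable_graph_spaceD)
        (rule measurable_compose[OF label_graph_measurable read_point_measurable])
    then have "?r \<in> measurable ?M (restrict_space borel B)"
      by (rule measurable_restrict_space2[rotated]) (use r(1) space in auto)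
    then show "(\<lambda>H. p (?r H)) \<in> measurable ?M Y"
      by (rule measurable_compose) (rule p(1))
  qed
  ultimately show ?thesis
    using that[OF \<phi>(1) sub meas iso] unfolding borel_bireducible_def by blast
qed

theorem theorem5p6:
  shows "invariantly_universal TYPE('b) graph_space epi_le graph_iso \<and>
    (\<forall>(Y :: 'b measure) R. standard_borel Y \<and> analytic_quasi_order Y R \<longrightarrow>
       (\<exists>\<phi>. is_sentence \<phi> \<and> Mod \<phi> \<subseteq> graphs \<and>
          borel_bireducible Y R (restrict_space graph_space (Mod \<phi>))
            (epi_le \<inter> Mod \<phi> \<times> Mod \<phi>)))"
proof
  have "graph_iso \<subseteq> epi_le \<inter> epi_le\<inverse>"
  proof (rule subrelI)
    fix H H' assume iso: "(H, H') \<in> graph_iso"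
    have "(H, H') \<in> epi_le" using graph_iso_epi_le iso by (rule subsetD)
    moreover have "(H', H) \<in> epi_le" using graph_iso_epi_le graph_iso_sym[OF iso] by (rule subsetD)
    ultimately show "(H, H') \<in> epi_le \<inter> epi_le\<inverse>" by simp
  qed
  moreover have "\<exists>B \<in> sets graph_space. graph_iso `` B \<subseteq> B \<and>
      borel_bireducible Y R (restrict_space graph_space B) (epi_le \<inter> B \<times> B)"
    if "standard_borel Y" "analytic_quasi_order Y R" for Y :: "'b measure" and R
    using bireducible_Mod[OF that] by metis
  ultimately show "invariantly_universal TYPE('b) graph_space epi_le graph_iso"
    unfolding invariantly_universal_def
    using standard_borel_graph_space analytic_quasi_order_epi_le analytic_equivalence_graph_iso by blast
  show "\<forall>(Y :: 'b measure) R. standard_borel Y \<and> analytic_quasi_order Y R \<longrightarrow>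
       (\<exists>\<phi>. is_sentence \<phi> \<and> Mod \<phi> \<subseteq> graphs \<and>
          borel_bireducible Y R (restrict_space graph_space (Mod \<phi>))
            (epi_le \<inter> Mod \<phi> \<times> Mod \<phi>))"
    using bireducible_Mod by metis
qed

end
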